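(* Let $p_0\ge1$ be an integer, and let $n_j$, $\epsilon(j)$ ($1\le j\le p_0$) and the symmetric $p_0\times p_0$ matrix $B=2\Theta$ be as in the context. For each integer $l\ge0$ put $$V_l^{(p_0)}(q)=\sum_{\lambda}\frac{q^{\frac12\widetilde\lambda B\widetilde\lambda^{t}}}{\prod_{j=1}^{p_0}\left(q^{\epsilon(j)};q^{\epsilon(j)}\right)_{\lambda_j}},$$ where the sum is over all sequences of non-negative integers $\lambda=(\lambda_1,\ldots,\lambda_{p_0})$ with $\sum_{k=1}^{p_0}n_k\lambda_k=l$, and $\widetilde\lambda_j=\epsilon(j)\lambda_j$. Then $$\sum_{l\ge0}q^{\frac{l^2}{p_0}}V_l^{(p_0)}(q)=1+\sum_{k>0}(-1)^kq^{k^2p_0+\frac{k(k-1)}{2}}(1+q^k).$$ Equivalently, $$\sum_{l\ge0}q^{\frac{l^2}{p_0}}V_l^{(p_0)}(q)=\prod_{n\ge1}(1-q^{(2p_0+1)n})(1-q^{(2p_0+1)n-p_0-1})(1-q^{(2p_0+1)n-p_0}),$$ and $$\frac{1}{(q;q)_\infty}\sum_{l\ge0}q^{\frac{l^2}{p_0}}V_l^{(p_0)}(q)=\prod_{\substack{n\ge1\\ n\not\equiv0,\,p_0,\,p_0+1\ (\mathrm{mod}\ 2p_0+1)}}(1-q^n)^{-1}.$$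
   Context: For an integer $p_0\ge1$: $n_j=j$ and $\epsilon(j)=1$ for $1\le j<p_0$; $n_{p_0}=1$ and $\epsilon(p_0)=-1$. The matrix $\Theta$ is defined through its inverse $\Theta^{-1}=(c_{ij})_{1\le i,j\le p_0}$, the symmetric tridiagonal matrix ($c_{ij}=c_{ji}$, $c_{ij}=0$ if $|i-j|\ge2$) with $c_{jj}=2$ for $1\le j\le p_0-2$, $c_{p_0-1,p_0-1}=1$ (if $p_0\ge2$), $c_{p_0,p_0}=-1$; $c_{j-1,j}=-1$ for $2\le j\le p_0-1$, and $c_{p_0-1,p_0}=1$ (if $p_0\ge2$). (For $p_0=1$ the matrix is $(-1)$.) The absolute value of its determinant is $p_0$. Set $B=2\Theta$. $q$-notation: $(a;x)_n=\prod_{i=0}^{n-1}(1-ax^i)$ and $(q;q)_\infty=\prod_{n\ge1}(1-q^n)$. The identities are identities of series in $q$, with rational functions of $q$ (including the factors $1/(q^{-1};q^{-1})_n$) expanded around $q=0$. *)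

theory Defs
  imports
    "HOL-Analysis.Infinite_Products"
    "HOL-Computational_Algebra.Formal_Laurent_Series"
    "Jordan_Normal_Form.Gauss_Jordan_Elimination"
    "Jordan_Normal_Form.Determinant"
begin

definition nn :: "nat \<Rightarrow> nat \<Rightarrow> nat" where
  "nn p0 j = (if j = p0 then 1 else j)"

definition eps :: "nat \<Rightarrow> nat \<Rightarrow> int" where
  "eps p0 j = (if j = p0 then -1 else 1)"

text \<open>Entries are indexed from 1, as in \<open>c\<^sub>i\<^sub>j\<close> with \<open>1 \<le> i, j \<le> p0\<close>; the library's matrices and
  vectors are indexed from 0, hence the shifts by \<open>Suc\<close> below.\<close>

definition c_upper :: "nat \<Rightarrow> nat \<Rightarrow> nat \<Rightarrow> rat" where
  "c_upper p0 i j =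
     (if i = j then (if j = p0 then -1 else if j + 1 = p0 then 1 else 2)
      else if j = i + 1 then (if j = p0 then 1 else -1)
      else 0)"

definition c_entry :: "nat \<Rightarrow> nat \<Rightarrow> nat \<Rightarrow> rat" where
  "c_entry p0 i j = c_upper p0 (min i j) (max i j)"

definition Theta_inv :: "nat \<Rightarrow> rat mat" where
  "Theta_inv p0 = Matrix.mat p0 p0 (\<lambda>(i, j). c_entry p0 (Suc i) (Suc j))"

text \<open>The inverse exists for all \<open>p0 \<ge> 1\<close>: see \<open>mat_inverse_Theta_inv\<close> below.\<close>

definition Theta :: "nat \<Rightarrow> rat mat" where
  "Theta p0 = the (mat_inverse (Theta_inv p0))"

definition B_mat :: "nat \<Rightarrow> rat mat" where
  "B_mat p0 = 2 \<cdot>\<^sub>m Theta p0"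

text \<open>Series in \<open>q\<close> with exponents in \<open>(1/p0)\<int>\<close> are formal Laurent series in \<open>t = q\<^bsup>1/p0\<^esup>\<close>, so
  \<open>q = t\<^bsup>p0\<^esup>\<close>. Inversion in the field of formal Laurent series is expansion around \<open>q = 0\<close>, and the
  metric on formal Laurent series is the \<open>t\<close>-adic one.\<close>

definition qq :: "nat \<Rightarrow> rat fls" where
  "qq p0 = fls_X ^ p0"

text \<open>\<open>q\<close> to a rational power \<open>r \<in> (1/p0)\<int>\<close>. On the exponents that occur below the floor is exact,
  see \<open>exponent_integral\<close>.\<close>

definition qpow :: "nat \<Rightarrow> rat \<Rightarrow> rat fls" where
  "qpow p0 r = fls_X powi \<lfloor>of_nat p0 * r\<rfloor>"

definition qpoch :: "'a::comm_ring_1 \<Rightarrow> 'a \<Rightarrow> nat \<Rightarrow> 'a" where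
  "qpoch a x n = (\<Prod>i<n. 1 - a * x ^ i)"

definition lam_tilde :: "nat \<Rightarrow> (nat \<Rightarrow> nat) \<Rightarrow> rat Matrix.vec" where
  "lam_tilde p0 lam = Matrix.vec p0 (\<lambda>i. of_int (eps p0 (Suc i)) * of_nat (lam (Suc i)))"

definition half_quad :: "nat \<Rightarrow> (nat \<Rightarrow> nat) \<Rightarrow> rat" where
  "half_quad p0 lam =
     1/2 * scalar_prod (lam_tilde p0 lam) (mult_mat_vec (B_mat p0) (lam_tilde p0 lam))"

definition Lam :: "nat \<Rightarrow> nat \<Rightarrow> (nat \<Rightarrow> nat) set" where
  "Lam p0 l = {lam \<in> {1..p0} \<rightarrow>\<^sub>E UNIV. (\<Sum>k=1..p0. nn p0 k * lam k) = l}"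

definition V :: "nat \<Rightarrow> nat \<Rightarrow> rat fls" where
  "V p0 l = (\<Sum>lam\<in>Lam p0 l.
     qpow p0 (half_quad p0 lam) /
     (\<Prod>j=1..p0. qpoch (qq p0 powi eps p0 j) (qq p0 powi eps p0 j) (lam j)))"

subsection \<open>Well-definedness\<close>

lemma finite_Lam: "finite (Lam p0 l)"
proof (rule finite_subset)
  show "Lam p0 l \<subseteq> {1..p0} \<rightarrow>\<^sub>E {0..l}"
  proof
    fix lam assume lam: "lam \<in> Lam p0 l"
    have "lam k \<le> l" if "k \<in> {1..p0}" for k
    proof -
      have "nn p0 k * lam k \<le> (\<Sum>k=1..p0. nn p0 k * lam k)"
        using that by (intro member_le_sum) auto
      then have "nn p0 k * lam k \<le> l" using lam by (simp add: Lam_def)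
      moreover have "nn p0 k \<ge> 1" using that by (auto simp: nn_def)
      ultimately show ?thesis
        by (metis le_trans mult.commute mult_le_mono2 nat_mult_1_right)
    qed
    then show "lam \<in> {1..p0} \<rightarrow>\<^sub>E {0..l}"
      using lam by (auto simp: Lam_def PiE_def Pi_def)
  qed
qed (auto intro: finite_PiE)

definition Theta_entry :: "nat \<Rightarrow> nat \<Rightarrow> nat \<Rightarrow> rat" where
  "Theta_entry p0 i j =
     (if i = p0 \<and> j = p0 then - 1 / of_nat p0
      else if i = p0 then of_nat j / of_nat p0
      else if j = p0 then of_nat i / of_nat p0
      else of_nat (min i j) - of_nat (i * j) / of_nat p0)"

lemma c_row_sum:
  assumes "1 \<le> i" "i \<le> p0"
  shows "(\<Sum>k=1..p0. c_entry p0 i k * x k) =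
     (if 1 < i then c_entry p0 i (i - 1) * x (i - 1) else 0) + c_entry p0 i i * x i +
     (if i < p0 then c_entry p0 i (i + 1) * x (i + 1) else 0)"
proof -
  have "(\<Sum>k=1..p0. c_entry p0 i k * x k) =
        (\<Sum>k\<in>{1..p0} \<inter> {i - 1, i, i + 1}. c_entry p0 i k * x k)"
    by (rule sum.mono_neutral_right)
       (auto simp: c_entry_def c_upper_def min_def max_def split: if_splits)
  also have "{1..p0} \<inter> {i - 1, i, i + 1} =
      (if 1 < i then {i - 1} else {}) \<union> {i} \<union> (if i < p0 then {i + 1} else {})"
    using assms by auto
  also have "(\<Sum>k\<in>\<dots>. c_entry p0 i k * x k) =
     (if 1 < i then c_entry p0 i (i - 1) * x (i - 1) else 0) + c_entry p0 i i * x i +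
     (if i < p0 then c_entry p0 i (i + 1) * x (i + 1) else 0)"
    using assms by auto
  finally show ?thesis .
qed

lemma c_Theta_entry:
  assumes "1 \<le> i" "i \<le> p0" "1 \<le> j" "j \<le> p0"
  shows "(\<Sum>k=1..p0. c_entry p0 i k * Theta_entry p0 k j) = (if i = j then 1 else 0)"
proof -
  obtain m where i: "i = Suc m" using assms by (cases i) auto
  have nz: "of_nat p0 \<noteq> (0::rat)" using assms by simp
  let ?T = "\<lambda>k. Theta_entry p0 k j"
  consider "i = p0" | "i + 1 = p0" | "i + 1 < p0" using assms by linarith
  then show ?thesis
  proof cases
    case 1
    then have p0: "p0 = Suc m" using i by simp
    have row: "(\<Sum>k=1..p0. c_entry p0 i k * ?T k) = (if m = 0 then 0 else ?T m) - ?T (Suc m)"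
      unfolding c_row_sum[OF assms(1,2)] using 1 i
      by (auto simp: c_entry_def c_upper_def)
    have nz': "1 + of_nat m \<noteq> (0::rat)" using nz p0 by simp
    show ?thesis
    proof (cases "j = Suc m")
      case True
      have "of_nat m / (1 + of_nat m) + 1 / (1 + of_nat m) = (1::rat)"
        using nz' by (simp add: add.commute flip: add_divide_distrib)
      then show ?thesis
        unfolding row using True i by (auto simp: p0 Theta_entry_def)
    next
      case False
      then have "j \<le> m" using assms p0 by linarith
      then show ?thesis
        unfolding row using i nz' assms
        by (auto simp: p0 Theta_entry_def min_def field_simps)
    qed
  next
    case 2
    then have p0: "p0 = Suc (Suc m)" using i by simp
    have m: "of_nat m = (of_nat p0 - 2 :: rat)" using p0 by simp
    have row: "(\<Sum>k=1..p0. c_entry p0 i k * ?T k) =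
        - (if m = 0 then 0 else ?T m) + ?T (Suc m) + ?T p0"
      unfolding c_row_sum[OF assms(1,2)] using 2 i
      by (auto simp: c_entry_def c_upper_def)
    consider "j = p0" | "j = Suc m" | "j \<le> m" using assms p0 by linarith
    then show ?thesis
    proof cases
      case 1
      then show ?thesis
        unfolding row using 2 i nz m by (auto simp: Theta_entry_def field_simps)
    next
      case j: 2
      then show ?thesis
        unfolding row using 2 i nz m by (auto simp: Theta_entry_def min_def field_simps)
    next
      case j: 3
      then have "j < p0" "j \<noteq> p0" "j \<noteq> Suc m" using p0 by auto
      then show ?thesis
        unfolding row using 2 i nz m j by (auto simp: Theta_entry_def min_def field_simps)
    qed
  next
    case 3
    have row: "(\<Sum>k=1..p0. c_entry p0 i k * ?T k) =
        - (if m = 0 then 0 else ?T m) + 2 * ?T (Suc m) - ?T (Suc (Suc m))"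
      unfolding c_row_sum[OF assms(1,2)] using 3 i
      by (auto simp: c_entry_def c_upper_def)
    consider "j = p0" | "j < p0" "j \<le> m" | "j < p0" "j = Suc m" | "j < p0" "j > Suc m"
      using assms by linarith
    then show ?thesis
      unfolding row using 3 i nz assms
      by cases (auto simp: Theta_entry_def min_def field_simps)
  qed
qed

definition Theta_mat :: "nat \<Rightarrow> rat mat" where
  "Theta_mat p0 = Matrix.mat p0 p0 (\<lambda>(i, j). Theta_entry p0 (Suc i) (Suc j))"

lemma Theta_inv_mult: "Theta_inv p0 * Theta_mat p0 = 1\<^sub>m p0"
proof (rule eq_matI)
  fix i j assume ij: "i < dim_row (1\<^sub>m p0 :: rat mat)" "j < dim_col (1\<^sub>m p0 :: rat mat)"
  have "index_mat (Theta_inv p0 * Theta_mat p0) (i, j) =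
        (\<Sum>k = 0..<p0. c_entry p0 (Suc i) (Suc k) * Theta_entry p0 (Suc k) (Suc j))"
    using ij by (simp add: Theta_inv_def Theta_mat_def scalar_prod_def)
  also have "\<dots> = (\<Sum>k=1..p0. c_entry p0 (Suc i) k * Theta_entry p0 k (Suc j))"
    by (rule sum.reindex_bij_witness[of _ "\<lambda>k. k - 1" Suc]) auto
  also have "\<dots> = (if Suc i = Suc j then 1 else 0)"
    using ij by (intro c_Theta_entry) auto
  finally show "index_mat (Theta_inv p0 * Theta_mat p0) (i, j) = index_mat (1\<^sub>m p0) (i, j)"
    using ij by simp
qed (auto simp: Theta_inv_def Theta_mat_def)

lemma mat_inverse_Theta_inv: "mat_inverse (Theta_inv p0) = Some (Theta_mat p0)"
proof -
  have A: "Theta_inv p0 \<in> carrier_mat p0 p0" and E: "Theta_mat p0 \<in> carrier_mat p0 p0"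
    by (auto simp: Theta_inv_def Theta_mat_def)
  have EA: "Theta_mat p0 * Theta_inv p0 = 1\<^sub>m p0"
    by (rule mat_mult_left_right_inverse[OF A E Theta_inv_mult])
  show ?thesis
  proof (cases "mat_inverse (Theta_inv p0)")
    case None
    have "Theta_inv p0 \<in> Units (ring_mat TYPE(rat) p0 ())"
      using A E EA Theta_inv_mult by (auto simp: Units_def ring_mat_def)
    then show ?thesis using mat_inverse(1)[OF A None, of "()"] by blast
  next
    case (Some B)
    have B: "Theta_inv p0 * B = 1\<^sub>m p0" "B \<in> carrier_mat p0 p0"
      using mat_inverse(2)[OF A Some] by auto
    have "Theta_mat p0 = Theta_mat p0 * (Theta_inv p0 * B)" using B E by simp
    also have "\<dots> = Theta_mat p0 * Theta_inv p0 * B"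
      by (rule assoc_mult_mat[symmetric, OF E A B(2)])
    also have "\<dots> = B" using B by (simp add: EA)
    finally show ?thesis using Some by simp
  qed
qed

lemma Theta_eq: "Theta p0 = Theta_mat p0"
  by (simp add: Theta_def mat_inverse_Theta_inv)

lemma exponent_integral:
  assumes "p0 \<ge> 1"
  shows "of_nat p0 * half_quad p0 lam \<in> \<int>"
proof -
  have entry: "of_nat p0 * Theta_entry p0 i j \<in> \<int>" for i j
    using assms by (auto simp: Theta_entry_def right_diff_distrib simp del: of_nat_mult)
  define v where "v = (\<lambda>i. of_int (eps p0 (Suc i)) * of_nat (lam (Suc i)) :: rat)"
  have v: "v i \<in> \<int>" for i by (simp add: v_def)
  have lt: "lam_tilde p0 lam = Matrix.vec p0 v" by (simp add: lam_tilde_def v_def)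
  have "half_quad p0 lam =
      (\<Sum>i=0..<p0. v i * (\<Sum>j=0..<p0. Theta_entry p0 (Suc i) (Suc j) * v j))"
    by (simp add: half_quad_def lt B_mat_def Theta_eq Theta_mat_def scalar_prod_def
        sum_distrib_left mult_ac)
  then have "of_nat p0 * half_quad p0 lam =
      (\<Sum>i=0..<p0. v i * (\<Sum>j=0..<p0. (of_nat p0 * Theta_entry p0 (Suc i) (Suc j)) * v j))"
    by (simp add: sum_distrib_left mult_ac)
  also have "\<dots> \<in> \<int>"
    by (intro Ints_sum Ints_mult v entry)
  finally show ?thesis .
qed

end

theory Submission
  imports Defs
begin

text \<open>
  Write \<open>P n\<close> for \<open>(q;q)\<^sub>n\<close> and \<open>N\<^sub>r = \<lambda>\<^sub>r + \<dots> + \<lambda>\<^bsub>p0-1\<^esub>\<close>.  Completing the square turns the exponent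
  \<open>l\<^sup>2/p0 + \<lambda>~ \<Theta> \<lambda>~\<^sup>t\<close> into \<open>N\<^sub>1\<^sup>2 + \<dots> + N\<^bsub>p0-1\<^esub>\<^sup>2\<close> (\<open>half_quad_completed\<close>), so \<open>\<lambda>\<^bsub>p0\<^esub>\<close>, the variable
  with negative sign, decouples from the others.  Its own sum is
  \<open>\<Sum>m. 1/(q\<^sup>-\<^sup>1;q\<^sup>-\<^sup>1)\<^sub>m = (q;q)\<^sub>\<infinity>\<close>, an identity of Euler, and the remaining variables give the
  multiple series of Andrews and Gordon.  The theorem is therefore \<open>(q;q)\<^sub>\<infinity>\<close> times the
  Andrews-Gordon identity, together with two ways of writing the theta series on its right.

  That identity is obtained by Bressoud's method.  For any sequence \<open>f\<close> let
  \<open>A f n = \<Sum>j\<le>n. f j / (P (n-j) P (n+j))\<close>.  The q-Vandermonde formula shows that multiplying \<open>f j\<close> by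
  \<open>q\<^bsup>j^2\<^esup>\<close> amounts to the summation \<open>A f \<mapsto> (\<lambda>n. \<Sum>s\<le>n. q\<^bsup>s^2\<^esup> A f s / P (n-s))\<close> (\<open>bailey_sum_step\<close>).
  At \<open>z = 1\<close> the finite Jacobi triple product has a vanishing factor, hence
  \<open>A f n = [n = 0]\<close> for \<open>f 0 = 1\<close>, \<open>f j = (-1)\<^sup>j q\<^bsup>j(j-1)/2\<^esup> (1 + q\<^sup>j)\<close>.  Starting there,
  \<open>k\<close> steps identify a \<open>k\<close>-fold nested sum with \<open>A (\<lambda>j. q\<^bsup>k j^2\<^esup> f j) n\<close> (\<open>nested_sum_eq_bailey_sum\<close>), for
  every finite \<open>n\<close>.

  The passage to the limit is a matter of congruences modulo \<open>t\<^sup>N\<close>, where \<open>q = t\<^bsup>p0\<^esup>\<close>: since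
  \<open>P m / P n \<equiv> 1\<close> modulo \<open>q\<^bsup>min m n + 1\<^esup>\<close>, the \<open>N\<close>-th partial sum of the left-hand side, the \<open>N\<close>-th
  partial sum of the theta series and the \<open>N\<close>-th partial product (the finite triple product in base
  \<open>q\<^bsup>2 p0 + 1\<^esup>\<close>) all agree modulo \<open>t\<^sup>N\<close> (\<open>partial_sum_near_theta\<close>, \<open>product_near_theta\<close>).  The last
  product arises from the triple product by cancelling \<open>(q;q)\<^sub>\<infinity>\<close> in blocks of \<open>2 p0 + 1\<close> factors
  (\<open>block_product\<close>).
\<close>

section \<open>The adic topology of formal Laurent series\<close>

text \<open>Stated through coefficients, so that the zero series satisfies it for every \<open>N\<close>; for nonzero
  series it bounds the subdegree from below.\<close>
definition ord_ge :: "int \<Rightarrow> 'a::zero fls \<Rightarrow> bool" where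
  "ord_ge N f \<longleftrightarrow> (\<forall>i<N. fls_nth f i = 0)"

lemma ord_ge_iff_subdegree: "ord_ge N f \<longleftrightarrow> f = 0 \<or> N \<le> fls_subdegree f"
  unfolding ord_ge_def by (metis fls_eq0_below_subdegree fls_subdegree_geI fls_zero_nth less_le_trans)

lemma ord_ge_mono: "ord_ge N f \<Longrightarrow> M \<le> N \<Longrightarrow> ord_ge M f"
  by (auto simp: ord_ge_def)

lemma ord_ge_0 [simp]: "ord_ge N 0"
  by (simp add: ord_ge_def)

lemma ord_ge_add: "ord_ge N f \<Longrightarrow> ord_ge N g \<Longrightarrow> ord_ge N (f + g)"
  for f g :: "'a::monoid_add fls"
  by (simp add: ord_ge_def)

lemma ord_ge_uminus: "ord_ge N (- f) \<longleftrightarrow> ord_ge N f"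
  for f :: "'a::group_add fls"
  by (simp add: ord_ge_def)

lemma ord_ge_diff: "ord_ge N f \<Longrightarrow> ord_ge N g \<Longrightarrow> ord_ge N (f - g)"
  for f g :: "'a::group_add fls"
  by (simp add: ord_ge_def)

lemma ord_ge_sum: "(\<And>x. x \<in> A \<Longrightarrow> ord_ge N (f x)) \<Longrightarrow> ord_ge N (sum f A)"
  for f :: "'b \<Rightarrow> 'a::comm_monoid_add fls"
  by (induction A rule: infinite_finite_induct) (auto intro: ord_ge_add)

lemma ord_ge_mult: "ord_ge M f \<Longrightarrow> ord_ge N g \<Longrightarrow> ord_ge (M + N) (f * g)"
  for f g :: "'a::idom fls"
  by (cases "f = 0"; cases "g = 0") (auto simp: ord_ge_iff_subdegree)

lemma ord_ge_one [simp]: "ord_ge 0 (1 :: 'a::zero_neq_one fls)"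
  by (simp add: ord_ge_iff_subdegree)

lemma ord_ge_mult_unit: "ord_ge N f \<Longrightarrow> ord_ge 0 g \<Longrightarrow> ord_ge N (f * g)"
  for f g :: "'a::idom fls"
  using ord_ge_mult[of N f 0 g] by simp

lemma ord_ge_prod: "(\<And>x. x \<in> A \<Longrightarrow> ord_ge 0 (f x)) \<Longrightarrow> ord_ge 0 (prod f A)"
  for f :: "'b \<Rightarrow> 'a::idom fls"
  by (induction A rule: infinite_finite_induct) (auto intro: ord_ge_mult_unit)

lemma ord_ge_sign: "ord_ge 0 ((-1) ^ k :: 'a::idom fls)"
  by (cases "even k") (auto simp: ord_ge_uminus)

lemma ord_ge_mult_diff:
  fixes f f' g g' :: "'a::idom fls"
  assumes "ord_ge N (f - f')" "ord_ge N (g - g')" "ord_ge 0 f" "ord_ge 0 g'"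
  shows "ord_ge N (f * g - f' * g')"
proof -
  have "f * g - f' * g' = (g - g') * f + (f - f') * g'" by (simp add: algebra_simps)
  then show ?thesis using assms by (auto intro!: ord_ge_add ord_ge_mult_unit)
qed

text \<open>Series of the form \<open>1 + O(t)\<close> are the units that occur as factors and denominators below; the
  next lemmas let congruences to \<open>1\<close> pass through products and inverses.\<close>
lemma near_one_subdegree:
  fixes f :: "'a::field fls"
  assumes "ord_ge N (f - 1)" "N \<ge> 1"
  shows "f \<noteq> 0" "fls_subdegree f = 0"
proof -
  have z: "fls_nth (f - 1) i = 0" if "i \<le> 0" for i using assms that by (auto simp: ord_ge_def)
  have c: "fls_nth f 0 = 1" "\<And>i. i < 0 \<Longrightarrow> fls_nth f i = 0" using z by force+
  then show "f \<noteq> 0" by auto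
  show "fls_subdegree f = 0" using c by (intro fls_subdegree_eqI) auto
qed

lemma near_one_integral:
  fixes f :: "'a::field fls"
  assumes "ord_ge N (f - 1)" "N \<ge> 1"
  shows "ord_ge 0 f" "ord_ge 0 (inverse f)"
  using near_one_subdegree[OF assms] by (auto simp: ord_ge_iff_subdegree)

lemma near_one_mult:
  fixes f g :: "'a::field fls"
  assumes "ord_ge N (f - 1)" "ord_ge N (g - 1)" "N \<ge> 1"
  shows "ord_ge N (f * g - 1)"
  using ord_ge_mult_diff[OF assms(1,2)] near_one_integral[OF assms(1,3)] by simp

lemma near_one_inverse:
  fixes f :: "'a::field fls"
  assumes "ord_ge N (f - 1)" "N \<ge> 1"
  shows "ord_ge N (inverse f - 1)"
proof -
  have "inverse f - 1 = - ((f - 1) * inverse f)"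
    using near_one_subdegree[OF assms] by (simp add: field_simps)
  then show ?thesis
    using near_one_integral[OF assms] assms by (auto simp: ord_ge_uminus intro!: ord_ge_mult_unit)
qed

lemma fls_ball_imp_ord_ge:
  fixes f g :: "'a::group_add fls"
  assumes "dist f g < inverse (2 ^ nat N)"
  shows "ord_ge N (f - g)"
proof (cases "f = g")
  case False
  show ?thesis
  proof (cases "fls_subdegree (f - g) \<ge> 0")
    case True
    have "inverse (2 ^ nat (fls_subdegree (f - g))) < (inverse (2 ^ nat N) :: real)"
      using assms False True by (simp add: dist_fls_def)
    then have "nat N < nat (fls_subdegree (f - g))" by simp
    then show ?thesis unfolding ord_ge_iff_subdegree by linarith
  next
    case neg: False
    have "(1::real) \<le> 2 ^ nat (- fls_subdegree (f - g))" by simp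
    also have "\<dots> < inverse (2 ^ nat N)" using assms False neg by (simp add: dist_fls_def)
    also have "\<dots> \<le> 1" by (simp add: field_simps)
    finally show ?thesis by simp
  qed
qed auto

lemma ord_ge_imp_fls_ball:
  fixes f g :: "'a::group_add fls"
  assumes "ord_ge (int N) (f - g)"
  shows "dist f g \<le> inverse (2 ^ N)"
proof (cases "f = g")
  case False
  then have "int N \<le> fls_subdegree (f - g)" using assms by (simp add: ord_ge_iff_subdegree)
  moreover from this have "(2::real) ^ N \<le> 2 ^ nat (fls_subdegree (f - g))"
    by (intro power_increasing) auto
  ultimately show ?thesis using False by (auto simp: dist_fls_def)
qed auto

text \<open>The sets \<open>a + t\<^sup>N K[[t]]\<close> form a neighbourhood base at \<open>a\<close>, so that limits can be computed by
  congruences alone, without further reference to the metric.\<close>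
lemma eventually_nhds_fls:
  "eventually P (nhds a) \<longleftrightarrow> (\<exists>N. \<forall>f. ord_ge N (f - a) \<longrightarrow> P f)"
  for a :: "'a::group_add fls"
proof
  assume "eventually P (nhds a)"
  then obtain e where e: "e > 0" "\<And>f. dist f a < e \<Longrightarrow> P f" by (auto simp: eventually_nhds_metric)
  obtain N where "inverse (2 ^ N) < e" using e(1) real_arch_pow_inv[of e "1/2"] by (auto simp: field_simps)
  then have "\<forall>f. ord_ge (int N) (f - a) \<longrightarrow> P f"
    using e(2) ord_ge_imp_fls_ball by (meson le_less_trans)
  then show "\<exists>N. \<forall>f. ord_ge N (f - a) \<longrightarrow> P f" by blast
next
  assume "\<exists>N. \<forall>f. ord_ge N (f - a) \<longrightarrow> P f"
  then obtain N where "\<And>f. ord_ge N (f - a) \<Longrightarrow> P f" by blast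
  then have "\<forall>f. dist f a < inverse (2 ^ nat N) \<longrightarrow> P f" using fls_ball_imp_ord_ge by blast
  then show "eventually P (nhds a)"
    unfolding eventually_nhds_metric by (intro exI[of _ "inverse (2 ^ nat N)"]) auto
qed

lemma tendsto_fls_iff: "(X \<longlongrightarrow> L) F \<longleftrightarrow> (\<forall>N. \<forall>\<^sub>F x in F. ord_ge N (X x - L))"
  for L :: "'a::group_add fls"
proof (intro iffI allI)
  fix N assume "(X \<longlongrightarrow> L) F"
  moreover have "\<forall>\<^sub>F f in nhds L. ord_ge N (f - L)" unfolding eventually_nhds_fls by blast
  ultimately show "\<forall>\<^sub>F x in F. ord_ge N (X x - L)" by (rule eventually_compose_filterlim[rotated])
next
  assume *: "\<forall>N. \<forall>\<^sub>F x in F. ord_ge N (X x - L)"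
  show "(X \<longlongrightarrow> L) F"
    unfolding filterlim_iff
  proof (intro allI impI)
    fix P assume "eventually P (nhds L)"
    then obtain N where "\<And>f. ord_ge N (f - L) \<Longrightarrow> P f" unfolding eventually_nhds_fls by blast
    then show "\<forall>\<^sub>F x in F. P (X x)" using *[rule_format, of N] by (auto elim: eventually_mono)
  qed
qed

text \<open>Needed for the general theory of infinite products. The factors may have poles, so the
  precision \<open>K\<close> demanded of them has to exceed \<open>N\<close> by the pole orders of the limits.\<close>
instance fls :: (idom) topological_semigroup_mult
proof
  fix a b :: "'a fls"
  have "\<forall>\<^sub>F x in nhds a \<times>\<^sub>F nhds b. ord_ge N (fst x * snd x - a * b)" for N
  proof -
    define d where "d = (\<lambda>f::'a fls. min 0 (fls_subdegree f))"
    have d: "ord_ge (d f) f" "d f \<le> 0" for f by (auto simp: ord_ge_iff_subdegree d_def)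
    \<comment> \<open>\<open>max N 0\<close> rather than \<open>N\<close>, so that the product of the two errors also has order at least \<open>N\<close>.\<close>
    define K where "K = max N 0 - d a - d b"
    have K: "K \<ge> 0" using d(2)[of a] d(2)[of b] by (simp add: K_def)
    have "ord_ge N (f * g - a * b)" if f: "ord_ge K (f - a)" and g: "ord_ge K (g - b)" for f g
    proof -
      have eq: "f * g - a * b = (f - a) * (g - b) + (f - a) * b + a * (g - b)"
        by (simp add: algebra_simps)
      have "ord_ge N ((f - a) * (g - b))"
        by (rule ord_ge_mono[OF ord_ge_mult[OF f g]]) (use K d(2)[of a] d(2)[of b] in \<open>simp add: K_def\<close>)
      moreover have "ord_ge N ((f - a) * b)"
        by (rule ord_ge_mono[OF ord_ge_mult[OF f d(1)]]) (use d(2)[of a] in \<open>simp add: K_def\<close>)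
      moreover have "ord_ge N (a * (g - b))"
        by (rule ord_ge_mono[OF ord_ge_mult[OF d(1) g]]) (use d(2)[of b] in \<open>simp add: K_def\<close>)
      ultimately show ?thesis unfolding eq by (intro ord_ge_add)
    qed
    moreover have "\<forall>\<^sub>F f in nhds a. ord_ge K (f - a)" "\<forall>\<^sub>F g in nhds b. ord_ge K (g - b)"
      by (auto simp: eventually_nhds_fls)
    ultimately show ?thesis unfolding eventually_prod_filter by fastforce
  qed
  then show "LIM x nhds a \<times>\<^sub>F nhds b. fst x * snd x :> nhds (a * b)"
    unfolding tendsto_fls_iff by blast
qed

lemma LIMSEQ_fls_near:
  fixes X Y :: "nat \<Rightarrow> 'a::ab_group_add fls"
  assumes "\<And>n. ord_ge (int n) (X n - Y n)" "Y \<longlonglongrightarrow> L"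
  shows "X \<longlonglongrightarrow> L"
  unfolding tendsto_fls_iff
proof
  fix N
  have "\<forall>\<^sub>F n in sequentially. ord_ge N (Y n - L)" using assms(2) by (simp add: tendsto_fls_iff)
  moreover have "\<forall>\<^sub>F n in sequentially. n \<ge> nat N" by (rule eventually_ge_at_top)
  ultimately show "\<forall>\<^sub>F n in sequentially. ord_ge N (X n - L)"
  proof eventually_elim
    case (elim n)
    have "ord_ge N (X n - Y n)" by (rule ord_ge_mono[OF assms(1)]) (use elim in linarith)
    from ord_ge_add[OF this elim(1)] show ?case by simp
  qed
qed

text \<open>Completeness of the subring of power series: the coefficient of \<open>t\<^sup>i\<close> does not change after
  step \<open>i + 1\<close>, and the limit is assembled from these stable coefficients.\<close>
lemma fls_Cauchy_limit:
  fixes X :: "nat \<Rightarrow> 'a::ring_1 fls"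
  assumes step: "\<And>n. ord_ge (int n) (X (Suc n) - X n)" and X0: "ord_ge 0 (X 0)"
  obtains L where "X \<longlonglongrightarrow> L" "\<And>n. ord_ge (int n) (X n - L)"
proof -
  have stable: "ord_ge (int n) (X (n + k) - X n)" for n k
  proof (induction k)
    case (Suc k)
    have "ord_ge (int n) (X (Suc (n + k)) - X (n + k))"
      by (rule ord_ge_mono[OF step]) simp
    from ord_ge_add[OF this Suc] show ?case by simp
  qed simp
  define L where "L = fps_to_fls (Abs_fps (\<lambda>i. fls_nth (X (Suc i)) (int i)))"
  have near: "ord_ge (int n) (X n - L)" for n
    unfolding ord_ge_def
  proof (intro allI impI)
    fix i assume i: "i < int n"
    show "fls_nth (X n - L) i = 0"
    proof (cases "i < 0")
      case True
      have "ord_ge 0 (X n - X 0)" using stable[of 0 n] by simp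
      from ord_ge_add[OF this X0] show ?thesis using True by (simp add: ord_ge_def L_def)
    next
      case False
      define m where "m = nat i"
      have m: "i = int m" "Suc m \<le> n" using False i by (auto simp: m_def)
      have "ord_ge (int (Suc m)) (X n - X (Suc m))" using stable[of "Suc m" "n - Suc m"] m by simp
      then show ?thesis by (simp add: ord_ge_def L_def m(1))
    qed
  qed
  moreover have "X \<longlonglongrightarrow> L" by (rule LIMSEQ_fls_near[of _ "\<lambda>_. L"]) (use near in auto)
  ultimately show ?thesis using that by blast
qed

lemma summable_fls:
  fixes f :: "nat \<Rightarrow> 'a::ring_1 fls"
  assumes "\<And>n. ord_ge (int n) (f n)"
  shows "summable f"
proof -
  obtain L where "(\<lambda>n. \<Sum>i<n. f i) \<longlonglongrightarrow> L"
    by (rule fls_Cauchy_limit[of "\<lambda>n. \<Sum>i<n. f i"]) (use assms in auto)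
  then show ?thesis unfolding summable_def sums_def by blast
qed

lemma fls_near_one_product:
  fixes f :: "nat \<Rightarrow> 'a::field fls"
  assumes "\<And>n. ord_ge (int (Suc n)) (f n - 1)"
  shows "convergent_prod f" "(\<lambda>n. \<Prod>i<n. f i) \<longlonglongrightarrow> prodinf f" "prodinf f \<noteq> 0"
proof -
  have near1: "ord_ge 1 ((\<Prod>i<n. f i) - 1)" for n
  proof (induction n)
    case (Suc n)
    have "ord_ge 1 (f n - 1)" by (rule ord_ge_mono[OF assms]) simp
    from near_one_mult[OF Suc this] show ?case by simp
  qed simp
  have step: "ord_ge (int n) ((\<Prod>i<Suc n. f i) - (\<Prod>i<n. f i))" for n
  proof -
    have "(\<Prod>i<Suc n. f i) - (\<Prod>i<n. f i) = (f n - 1) * (\<Prod>i<n. f i)" by (simp add: algebra_simps)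
    moreover have "ord_ge (int (Suc n)) \<dots>"
      by (intro ord_ge_mult_unit assms near_one_integral[OF near1]) simp
    ultimately show ?thesis by (metis ord_ge_mono of_nat_le_iff le_SucI order_refl)
  qed
  obtain L where L: "(\<lambda>n. \<Prod>i<n. f i) \<longlonglongrightarrow> L" "\<And>n. ord_ge (int n) ((\<Prod>i<n. f i) - L)"
    using fls_Cauchy_limit[OF step] by auto
  have "ord_ge 1 (L - 1)"
    using ord_ge_diff[OF near1[of 1] ord_ge_mono[OF L(2)[of 1], of 1]] by simp
  then have L0: "L \<noteq> 0" using near_one_subdegree by blast
  have "f n \<noteq> 0" for n using near_one_subdegree(1)[OF assms, of n] by simp
  moreover have L': "(\<lambda>n. \<Prod>i\<le>n. f i) \<longlonglongrightarrow> L" using L(1) by (simp add: LIMSEQ_lessThan_iff_atMost)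
  ultimately show "convergent_prod f" using L0 convergent_prod_iff_nz_lim[of f] by blast
  have "prodinf f = L" using prodinf_eq_prod_lim[OF L' L0] .
  then show "(\<lambda>n. \<Prod>i<n. f i) \<longlonglongrightarrow> prodinf f" "prodinf f \<noteq> 0" using L(1) L0 by auto
qed

section \<open>Finite q-series identities\<close>

lemma qpoch_Suc: "qpoch q q (Suc n) = qpoch q q n * (1 - q ^ Suc n)"
  by (simp add: qpoch_def)

lemma qpoch_0 [simp]: "qpoch a x 0 = 1"
  by (simp add: qpoch_def)

lemma triangle_Suc: "Suc m * m div 2 = m * (m - 1) div 2 + m"
proof -
  have "Suc m * m = m * (m - 1) + 2 * m" by (cases m) (auto simp: algebra_simps)
  then show ?thesis by simp
qed

text \<open>Folding a bilateral sum over \<open>-N \<le> j \<le> N\<close>, shifted by \<open>N\<close>, into a sum over \<open>0 \<le> j \<le> N\<close>; the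
  central term is not doubled. All theta series below are written in this folded form.\<close>
lemma sum_fold_center:
  "(\<Sum>m\<le>2 * N. f m) = (\<Sum>j\<le>N. if j = 0 then f N else f (N + j) + f (N - j))"
  for f :: "nat \<Rightarrow> 'b::comm_monoid_add"
proof -
  have "(\<Sum>m\<le>2 * N. f m) = (\<Sum>m\<in>{N} \<union> ((+) N ` {1..N} \<union> (-) N ` {1..N}). f m)"
  proof (intro sum.cong refl equalityI subsetI)
    fix m assume m: "m \<in> {..2 * N}"
    show "m \<in> {N} \<union> ((+) N ` {1..N} \<union> (-) N ` {1..N})"
    proof (cases m N rule: linorder_cases)
      case less
      then have "m = N - (N - m)" "N - m \<in> {1..N}" by auto
      then show ?thesis by blast
    next
      case greater
      then have "m = N + (m - N)" "m - N \<in> {1..N}" using m by auto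
      then show ?thesis by blast
    qed auto
  qed auto
  also have "\<dots> = f N + ((\<Sum>j\<in>{1..N}. f (N + j)) + (\<Sum>j\<in>{1..N}. f (N - j)))"
  proof -
    have "sum f ((+) N ` {1..N}) = (\<Sum>j\<in>{1..N}. f (N + j))"
      by (rule sum.reindex_cong[of "(+) N"]) auto
    moreover have "sum f ((-) N ` {1..N}) = (\<Sum>j\<in>{1..N}. f (N - j))"
      by (rule sum.reindex_cong[of "(-) N"]) (auto simp: inj_on_def)
    moreover have "(+) N ` {1..N} \<inter> (-) N ` {1..N} = {}" by auto
    moreover have "{N} \<inter> ((+) N ` {1..N} \<union> (-) N ` {1..N}) = {}" by auto
    ultimately show ?thesis
      by (simp only: sum.union_disjoint finite_imageI finite_atLeastAtMost finite_Un finite.intros) simp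
  qed
  also have "\<dots> = f N + (\<Sum>j\<in>{1..N}. f (N + j) + f (N - j))" by (simp add: sum.distrib)
  also have "\<dots> = (\<Sum>j\<in>insert 0 {1..N}. if j = 0 then f N else f (N + j) + f (N - j))"
    by (subst sum.insert) auto
  also have "insert 0 {1..N} = {..N}" by auto
  finally show ?thesis .
qed

lemma double_triangle: "2 * (k * (k - 1) div 2) + k = k * k" for k :: nat
proof -
  have "even (k * (k - 1))" by (cases k) auto
  then have "2 * (k * (k - 1) div 2) = k * (k - 1)" by (rule even_two_times_div_two)
  then show ?thesis by (cases k) auto
qed

text \<open>The exponents of \<open>q\<close> at the positions \<open>N + j\<close> and \<open>N - j\<close> of the \<open>2N\<close>-th Rothe sum with
  \<open>a = q\<^sup>N\<close>, compared with the central one.\<close>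
lemma center_exponents:
  fixes j N :: nat
  assumes "j \<le> N"
  shows "(N + j) * (N + j - 1) div 2 + N * (N - j) = N * (N - 1) div 2 + N * N + j * (j - 1) div 2"
    and "(N - j) * (N - j - 1) div 2 + N * (N + j) = N * (N - 1) div 2 + N * N + j * (j - 1) div 2 + j"
proof -
  obtain d where N: "N = j + d" using assms le_iff_add by blast
  then have d: "N - j = d" by simp
  have prods: "(N + j) * (N + j) = N * N + 2 * (N * j) + j * j" "N * N = N * j + N * d"
    "d * d + 2 * (N * j) = N * N + j * j" "N * (N + j) = N * N + N * j"
    unfolding N by (simp_all add: algebra_simps)
  show "(N + j) * (N + j - 1) div 2 + N * (N - j) = N * (N - 1) div 2 + N * N + j * (j - 1) div 2"
    using prods double_triangle[of "N + j"] double_triangle[of N] double_triangle[of j]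
    unfolding d by linarith
  show "(N - j) * (N - j - 1) div 2 + N * (N + j) = N * (N - 1) div 2 + N * N + j * (j - 1) div 2 + j"
    using prods double_triangle[of d] double_triangle[of N] double_triangle[of j] N
    unfolding d by linarith
qed

locale q_base =
  fixes q :: "'a::field"
  assumes q_nonzero: "q \<noteq> 0" and not_root_of_unity: "n > 0 \<Longrightarrow> q ^ n \<noteq> 1"
begin

abbreviation qfact :: "nat \<Rightarrow> 'a" where "qfact n \<equiv> qpoch q q n"

lemma qfact_nonzero [simp]: "qfact n \<noteq> 0"
  by (induction n) (use not_root_of_unity[of "Suc _"] in \<open>auto simp: qpoch_Suc simp del: power_Suc\<close>)

definition qbinomial :: "nat \<Rightarrow> nat \<Rightarrow> 'a" where
  "qbinomial n k = (if k \<le> n then qfact n / (qfact k * qfact (n - k)) else 0)"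

lemma qbinomial_0 [simp]: "qbinomial n 0 = 1"
  by (simp add: qbinomial_def)

lemma qbinomial_eq_0 [simp]: "n < k \<Longrightarrow> qbinomial n k = 0"
  by (simp add: qbinomial_def)

lemma qbinomial_self [simp]: "qbinomial n n = 1"
  by (simp add: qbinomial_def)

lemma qbinomial_Pascal:
  "qbinomial (Suc n) (Suc k) = q ^ Suc k * qbinomial n (Suc k) + qbinomial n k"
  "k \<le> n \<Longrightarrow> qbinomial (Suc n) (Suc k) = qbinomial n (Suc k) + q ^ (n - k) * qbinomial n k"
proof -
  have *: "qbinomial (Suc n) (Suc k) = q ^ Suc k * qbinomial n (Suc k) + qbinomial n k \<and>
        qbinomial (Suc n) (Suc k) = qbinomial n (Suc k) + q ^ (n - k) * qbinomial n k" if "k < n"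
  proof -
    obtain d where "n = Suc (k + d)" using less_imp_Suc_add[OF \<open>k < n\<close>] by blast
    then have n: "n = k + Suc d" by simp
    have nz: "1 - q ^ Suc k \<noteq> 0" "1 - q ^ Suc d \<noteq> 0"
      using not_root_of_unity[of "Suc _"] by (simp_all del: power_Suc)
    have e: "qbinomial (Suc n) (Suc k) =
             qfact n * (1 - q ^ (Suc k + Suc d)) / (qfact k * (1 - q ^ Suc k) * (qfact d * (1 - q ^ Suc d)))"
      "qbinomial n (Suc k) = qfact n * (1 - q ^ Suc d) / (qfact k * (1 - q ^ Suc k) * (qfact d * (1 - q ^ Suc d)))"
      "qbinomial n k = qfact n * (1 - q ^ Suc k) / (qfact k * (1 - q ^ Suc k) * (qfact d * (1 - q ^ Suc d)))"
      using nz by (simp_all add: qbinomial_def n qpoch_Suc[of q "Suc (k + d)"] qpoch_Suc[of q k] qpoch_Suc[of q d] del: power_Suc)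
    have nk: "n - k = Suc d" using n by simp
    show ?thesis
      unfolding e nk power_add divide_inverse
      by (simp add: algebra_simps del: power_Suc inverse_mult_distrib)
  qed
  then show "qbinomial (Suc n) (Suc k) = q ^ Suc k * qbinomial n (Suc k) + qbinomial n k"
    by (cases "k < n"; cases "k = n") auto
  show "k \<le> n \<Longrightarrow> qbinomial (Suc n) (Suc k) = qbinomial n (Suc k) + q ^ (n - k) * qbinomial n k"
    using * by (cases "k < n"; cases "k = n") auto
qed

text \<open>The finite q-binomial theorem, in homogeneous form: the second variable \<open>a\<close> will be taken to be
  \<open>q\<^sup>N\<close>, which avoids negative powers of \<open>q\<close>.\<close>
lemma Rothe:
  "(\<Prod>i<n. a - b * q ^ i) =
   (\<Sum>m\<le>n. (-1) ^ m * q ^ (m * (m - 1) div 2) * qbinomial n m * b ^ m * a ^ (n - m))"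
proof (induction n)
  case (Suc n)
  define c where "c n m = (-1) ^ m * q ^ (m * (m - 1) div 2) * qbinomial n m * b ^ m * a ^ (n - m)" for n m
  have step: "c (Suc n) (Suc m) = a * c n (Suc m) - b * q ^ n * c n m" if "m \<le> n" for m
  proof -
    have ring: "-s * (Q * M) * (X + D * Y) * (b * B) * A =
          a * (-s * (Q * M) * X * (b * B) * A') - b * (D * M) * (s * Q * Y * B * A)"
      if "X * A = a * (X * A')" for s Q M X D Y B A A' :: 'a
    proof -
      have "-s * (Q * M) * (X + D * Y) * (b * B) * A = -s * Q * M * b * B * (X * A) - b * (D * M) * (s * Q * Y * B * A)"
        by (simp add: algebra_simps)
      then show ?thesis unfolding that by (simp add: algebra_simps)
    qed
    have "n - m = Suc (n - Suc m)" if "m \<noteq> n" using that \<open>m \<le> n\<close> by simp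
    then have A: "qbinomial n (Suc m) * a ^ (n - m) = a * (qbinomial n (Suc m) * a ^ (n - Suc m))"
      by (cases "m = n") simp_all
    have t: "Suc m * (Suc m - 1) div 2 = m * (m - 1) div 2 + m" using triangle_Suc[of m] by simp
    have sgn: "(-1 :: 'a) ^ Suc m = - ((-1) ^ m)" by simp
    have qn: "q ^ n = q ^ (n - m) * q ^ m" using that by (simp flip: power_add)
    show ?thesis
      unfolding c_def qbinomial_Pascal(2)[OF that] t diff_Suc_Suc sgn power_add qn power_Suc[of b]
      by (rule ring[OF A])
  qed
  have "c n (Suc n) = 0" by (simp add: c_def)
  have "(\<Prod>i<Suc n. a - b * q ^ i) = (\<Sum>m\<le>n. c n m) * (a - b * q ^ n)"
    using Suc by (simp add: c_def)
  also have "\<dots> = (\<Sum>m\<le>Suc n. a * c n m) - (\<Sum>m\<le>n. b * q ^ n * c n m)"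
    using \<open>c n (Suc n) = 0\<close> by (simp add: right_diff_distrib sum_distrib_left mult_ac)
  also have "\<dots> = a * c n 0 + (\<Sum>m\<le>n. a * c n (Suc m) - b * q ^ n * c n m)"
    by (simp add: sum.atMost_Suc_shift sum_subtractf del: sum.atMost_Suc)
  also have "\<dots> = c (Suc n) 0 + (\<Sum>m\<le>n. c (Suc n) (Suc m))"
    using step by (simp add: c_def)
  also have "\<dots> = (\<Sum>m\<le>Suc n. c (Suc n) m)"
    by (simp add: sum.atMost_Suc_shift del: sum.atMost_Suc)
  finally show ?case by (simp add: c_def)
qed simp

text \<open>Pascal's rule splits the sum for \<open>M + 1\<close> into two sums over \<open>r \<le> M\<close>, whose \<open>r\<close>-th terms
  combine to the \<open>r\<close>-th term of the sum for \<open>M\<close> with \<open>a + 1\<close> in place of \<open>a\<close>. So the induction on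
  \<open>M\<close> must leave \<open>a\<close> free.\<close>
lemma q_Vandermonde:
  "(\<Sum>r\<le>M. qbinomial M r * q ^ (r * (r + a)) / qfact (r + a)) = 1 / qfact (M + a)"
proof (induction M arbitrary: a)
  case (Suc M)
  have 1: "q ^ (r * Suc (r + a)) / qfact (r + a) + q ^ (Suc r * Suc (r + a)) / qfact (Suc (r + a))
      = q ^ (r * Suc (r + a)) / qfact (Suc (r + a))" for r
  proof -
    have alg: "x / F + x * y / (F * (1 - y)) = x / (F * (1 - y))" if "y \<noteq> 1" "F \<noteq> 0" for x y F :: 'a
      using that by (simp add: field_simps)
    have "Suc r * Suc (r + a) = r * Suc (r + a) + Suc (r + a)" by simp
    then have e: "q ^ (Suc r * Suc (r + a)) = q ^ (r * Suc (r + a)) * q ^ Suc (r + a)"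
      by (simp only: power_add)
    show ?thesis
      unfolding e qpoch_Suc
      by (rule alg) (use not_root_of_unity[of "Suc (r + a)"] in \<open>simp_all del: power_Suc\<close>)
  qed
  have "(\<Sum>r\<le>Suc M. qbinomial (Suc M) r * q ^ (r * (r + a)) / qfact (r + a)) =
     1 / qfact a + (\<Sum>r\<le>M. (q ^ Suc r * qbinomial M (Suc r) + qbinomial M r) *
          q ^ (Suc r * Suc (r + a)) / qfact (Suc (r + a)))"
    by (simp only: sum.atMost_Suc_shift qbinomial_Pascal add_Suc) simp
  also have "\<dots> = (1 / qfact a + (\<Sum>r\<le>M. qbinomial M (Suc r) * q ^ (Suc r * Suc (Suc r + a)) / qfact (Suc r + a)))
       + (\<Sum>r\<le>M. qbinomial M r * q ^ (Suc r * Suc (r + a)) / qfact (Suc (r + a)))"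
    by (simp add: sum.distrib add_divide_distrib algebra_simps power_add)
  also have "1 / qfact a + (\<Sum>r\<le>M. qbinomial M (Suc r) * q ^ (Suc r * Suc (Suc r + a)) / qfact (Suc r + a))
     = (\<Sum>r\<le>Suc M. qbinomial M r * q ^ (r * Suc (r + a)) / qfact (r + a))"
    by (simp add: sum.atMost_Suc_shift del: sum.atMost_Suc)
  also have "\<dots> = (\<Sum>r\<le>M. qbinomial M r * q ^ (r * Suc (r + a)) / qfact (r + a))"
    by simp
  also have "\<dots> + (\<Sum>r\<le>M. qbinomial M r * q ^ (Suc r * Suc (r + a)) / qfact (Suc (r + a))) =
     (\<Sum>r\<le>M. qbinomial M r * (q ^ (r * Suc (r + a)) / qfact (r + a) + q ^ (Suc r * Suc (r + a)) / qfact (Suc (r + a))))"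
    by (simp add: sum.distrib algebra_simps)
  also have "\<dots> = (\<Sum>r\<le>M. qbinomial M r * q ^ (r * (r + Suc a)) / qfact (r + Suc a))"
    unfolding 1 by simp
  also have "\<dots> = 1 / qfact (M + Suc a)" by (rule Suc)
  finally show ?case by simp
qed simp

text \<open>The sequence \<open>\<beta>\<close> of the Bailey pair relative to \<open>1\<close> whose sequence \<open>\<alpha>\<close> is \<open>t\<close>.\<close>
definition bailey_sum :: "(nat \<Rightarrow> 'a) \<Rightarrow> nat \<Rightarrow> 'a" where
  "bailey_sum t n = (\<Sum>j\<le>n. t j / (qfact (n - j) * qfact (n + j)))"

text \<open>A limiting case of Bailey's lemma. After interchanging the sums, the inner sum over
  \<open>s = j + r\<close> is the q-Vandermonde sum with \<open>M = n - j\<close> and \<open>a = 2 j\<close>, because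
  \<open>(j + r)\<^sup>2 = j\<^sup>2 + r (r + 2 j)\<close>.\<close>
lemma bailey_sum_step:
  "bailey_sum (\<lambda>j. q ^ (j\<^sup>2) * t j) n = (\<Sum>s\<le>n. q ^ (s\<^sup>2) / qfact (n - s) * bailey_sum t s)"
proof -
  have inner: "(\<Sum>s=j..n. q ^ (s\<^sup>2) / (qfact (n - s) * qfact (s - j) * qfact (s + j))) =
       q ^ (j\<^sup>2) / (qfact (n - j) * qfact (n + j))" if "j \<le> n" for j
  proof -
    define M where "M = n - j"
    have n: "n = M + j" using that by (simp add: M_def)
    have "(\<Sum>s=j..n. q ^ (s\<^sup>2) / (qfact (n - s) * qfact (s - j) * qfact (s + j))) =
          (\<Sum>r\<le>M. q ^ ((r + j)\<^sup>2) / (qfact (M - r) * qfact r * qfact (r + 2 * j)))"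
      unfolding n by (rule sum.reindex_bij_witness[of _ "\<lambda>r. r + j" "\<lambda>s. s - j"]) (auto simp: mult_2 add_ac)
    also have "\<dots> = (\<Sum>r\<le>M. q ^ (j\<^sup>2) / qfact M * (qbinomial M r * q ^ (r * (r + 2 * j)) / qfact (r + 2 * j)))"
    proof (intro sum.cong refl)
      fix r assume "r \<in> {..M}"
      moreover have "(r + j)\<^sup>2 = j\<^sup>2 + r * (r + 2 * j)" by (simp add: power2_eq_square algebra_simps)
      ultimately show "q ^ ((r + j)\<^sup>2) / (qfact (M - r) * qfact r * qfact (r + 2 * j)) =
          q ^ (j\<^sup>2) / qfact M * (qbinomial M r * q ^ (r * (r + 2 * j)) / qfact (r + 2 * j))"
        by (simp add: qbinomial_def power_add)
    qed
    also have "\<dots> = q ^ (j\<^sup>2) / qfact M * (1 / qfact (M + 2 * j))"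
      unfolding sum_distrib_left[symmetric] q_Vandermonde ..
    finally show ?thesis by (simp add: n mult_2 add_ac)
  qed
  have "(\<Sum>s\<le>n. q ^ (s\<^sup>2) / qfact (n - s) * bailey_sum t s) =
     (\<Sum>s\<le>n. \<Sum>j\<le>s. t j * (q ^ (s\<^sup>2) / (qfact (n - s) * qfact (s - j) * qfact (s + j))))"
    by (simp add: bailey_sum_def sum_distrib_left mult_ac)
  also have "\<dots> = (\<Sum>j\<le>n. \<Sum>s=j..n. t j * (q ^ (s\<^sup>2) / (qfact (n - s) * qfact (s - j) * qfact (s + j))))"
    by (simp add: sum.Sigma) (rule sum.reindex_bij_witness[of _ prod.swap prod.swap], auto)
  also have "\<dots> = (\<Sum>j\<le>n. t j * (q ^ (j\<^sup>2) / (qfact (n - j) * qfact (n + j))))"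
    unfolding sum_distrib_left[symmetric] by (intro sum.cong refl) (simp add: inner)
  finally show ?thesis by (simp add: bailey_sum_def mult_ac)
qed

text \<open>The terms with indices \<open>j\<close> and \<open>-j\<close> of the bilateral series
  \<open>\<Sum>j. (-1)\<^sup>j z\<^sup>j q\<^bsup>j(j-1)/2\<^esup>\<close>, added up; here \<open>w\<close> stands for \<open>q/z\<close>.\<close>
definition theta_term :: "'a \<Rightarrow> 'a \<Rightarrow> nat \<Rightarrow> 'a" where
  "theta_term z w j = (if j = 0 then 1 else (-1) ^ j * q ^ (j * (j - 1) div 2) * (z ^ j + w ^ j))"

text \<open>Rothe's identity with \<open>2N\<close> factors, \<open>a = q\<^sup>N\<close> and \<open>b = z\<close>: in the first \<open>N\<close> factors
  \<open>q\<^sup>N - z q\<^sup>i = -z q\<^sup>i (1 - w q\<^bsup>N-1-i\<^esup>)\<close>, in the last \<open>N\<close> ones \<open>q\<^sup>N\<close> can be taken out. The factors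
  taken out form \<open>pre\<close>, which is also common to all terms of the sum.\<close>
lemma finite_Jacobi_triple_product:
  assumes zw: "z * w = q"
  shows "(\<Prod>i<N. (1 - z * q ^ i) * (1 - w * q ^ i)) = qfact (2 * N) * bailey_sum (theta_term z w) N"
proof -
  have z0: "z \<noteq> 0" using zw q_nonzero by auto
  define T where "T = N * (N - 1) div 2"
  \<comment> \<open>the central term of the Rothe sum, up to the factor \<open>qbinomial (2 * N) N\<close>\<close>
  define pre where "pre = (-z) ^ N * q ^ (T + N * N)"
  have pre0: "pre \<noteq> 0" using z0 q_nonzero by (simp add: pre_def)
  define c where "c m = (-1) ^ m * q ^ (m * (m - 1) div 2) * qbinomial (2 * N) m * z ^ m * (q ^ N) ^ (2 * N - m)" for m
  have "(\<Prod>i<2 * N. q ^ N - z * q ^ i) = (\<Prod>i<N. q ^ N - z * q ^ i) * (\<Prod>i<N. q ^ N - z * q ^ (N + i))"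
  proof -
    have "{..<2 * N} = {..<N} \<union> (+) N ` {..<N}"
      by (auto simp: image_iff) (metis add_diff_inverse_nat add_less_cancel_left lessThan_iff mult_2)
    then have "(\<Prod>i<2 * N. q ^ N - z * q ^ i) = (\<Prod>i\<in>{..<N} \<union> (+) N ` {..<N}. q ^ N - z * q ^ i)" by simp
    also have "\<dots> = (\<Prod>i<N. q ^ N - z * q ^ i) * (\<Prod>i<N. q ^ N - z * q ^ (N + i))"
      by (subst prod.union_disjoint) (auto simp: prod.reindex)
    finally show ?thesis .
  qed
  also have "(\<Prod>i<N. q ^ N - z * q ^ (N + i)) = q ^ (N * N) * (\<Prod>i<N. 1 - z * q ^ i)"
  proof -
    have "(\<Prod>i<N. q ^ N - z * q ^ (N + i)) = (\<Prod>i<N. q ^ N * (1 - z * q ^ i))"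
      by (simp add: algebra_simps power_add)
    then show ?thesis by (simp add: prod.distrib power_mult)
  qed
  also have "(\<Prod>i<N. q ^ N - z * q ^ i) = (-z) ^ N * q ^ T * (\<Prod>i<N. 1 - w * q ^ i)"
  proof -
    have "(\<Prod>i<N. q ^ N - z * q ^ i) = (\<Prod>i<N. (-z) * q ^ i * (1 - w * q ^ (N - Suc i)))"
    proof (intro prod.cong refl)
      fix i assume "i \<in> {..<N}"
      then have "q ^ N = q ^ i * q ^ (N - Suc i) * (z * w)"
        by (simp add: zw flip: power_add power_Suc2 power_Suc)
      then show "q ^ N - z * q ^ i = (-z) * q ^ i * (1 - w * q ^ (N - Suc i))"
        by (simp add: algebra_simps)
    qed
    also have "\<dots> = (-z) ^ N * (\<Prod>i<N. q ^ i) * (\<Prod>i<N. 1 - w * q ^ (N - Suc i))"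
      by (simp only: prod.distrib prod_constant card_lessThan)
    also have "(\<Prod>i<N. 1 - w * q ^ (N - Suc i)) = (\<Prod>i<N. 1 - w * q ^ i)"
      by (rule prod.nat_diff_reindex)
    also have "(\<Prod>i<N. q ^ i) = q ^ T"
      unfolding T_def by (simp add: power_sum[symmetric] lessThan_atLeast0 Sum_Ico_nat)
    finally show ?thesis .
  qed
  finally have lhs: "(\<Prod>i<2 * N. q ^ N - z * q ^ i) = pre * (\<Prod>i<N. (1 - z * q ^ i) * (1 - w * q ^ i))"
    by (simp add: pre_def prod.distrib power_add mult_ac)
  have up: "c (N + j) = pre * (qfact (2 * N) * ((-1) ^ j * q ^ (j * (j - 1) div 2) * z ^ j / (qfact (N - j) * qfact (N + j))))"
    if j: "j \<le> N" for j
  proof -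
    note e = center_exponents(1)[OF j, folded T_def]
    have "c (N + j) = (-1) ^ (N + j) * q ^ ((N + j) * (N + j - 1) div 2 + N * (N - j)) * z ^ (N + j) * qbinomial (2 * N) (N + j)"
    proof -
      have "2 * N - (N + j) = N - j" by simp
      then show ?thesis
        unfolding c_def power_add[of q] power_mult[of q N] by (simp only: mult_ac)
    qed
    then show ?thesis
      unfolding e using j by (simp add: qbinomial_def pre_def power_add power_minus[of z] mult_2 mult_ac)
  qed
  have down: "c (N - j) = pre * (qfact (2 * N) * ((-1) ^ j * q ^ (j * (j - 1) div 2) * w ^ j / (qfact (N - j) * qfact (N + j))))"
    if j: "j \<le> N" for j
  proof -
    note e = center_exponents(2)[OF j, folded T_def]
    have "c (N - j) = (-1) ^ (N - j) * q ^ ((N - j) * (N - j - 1) div 2 + N * (N + j)) * z ^ (N - j) * qbinomial (2 * N) (N - j)"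
    proof -
      have "2 * N - (N - j) = N + j" using j by simp
      then show ?thesis
        unfolding c_def power_add[of q "(N - j) * (N - j - 1) div 2"] power_mult[of q N] by (simp only: mult_ac)
    qed
    moreover have "q ^ j * z ^ (N - j) = w ^ j * z ^ N"
      unfolding zw[symmetric] using j by (simp add: power_mult_distrib mult_ac flip: power_add)
    moreover have "(-1::'a) ^ (N - j) = (-1) ^ N * (-1) ^ j"
      using j by (simp add: minus_one_power_iff)
    ultimately show ?thesis
      unfolding e using j by (simp add: qbinomial_def pre_def power_add power_minus[of z] mult_2 mult_ac)
  qed
  have "pre * (\<Prod>i<N. (1 - z * q ^ i) * (1 - w * q ^ i)) = (\<Sum>m\<le>2 * N. c m)"
    unfolding lhs[symmetric] Rothe c_def ..
  also have "\<dots> = (\<Sum>j\<le>N. if j = 0 then c N else c (N + j) + c (N - j))" by (rule sum_fold_center)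
  also have "\<dots> = (\<Sum>j\<le>N. pre * (qfact (2 * N) * (theta_term z w j / (qfact (N - j) * qfact (N + j)))))"
  proof (intro sum.cong refl)
    fix j assume "j \<in> {..N}"
    then show "(if j = 0 then c N else c (N + j) + c (N - j)) =
        pre * (qfact (2 * N) * (theta_term z w j / (qfact (N - j) * qfact (N + j))))"
      using up[of 0] up[of j] down[of j] by (simp add: theta_term_def add_divide_distrib distrib_left)
  qed
  also have "\<dots> = pre * (qfact (2 * N) * bailey_sum (theta_term z w) N)"
    by (simp add: bailey_sum_def sum_distrib_left)
  finally show ?thesis using pre0 by simp
qed

text \<open>Unfolded, \<open>nested_sum k n\<close> is the sum over \<open>n \<ge> s\<^sub>1 \<ge> \<dots> \<ge> s\<^sub>k = 0\<close> of
  \<open>q\<^bsup>s_1^2 + \<dots> + s_k^2\<^esup> / (P (n - s\<^sub>1) P (s\<^sub>1 - s\<^sub>2) \<dots> P (s\<^bsub>k-1\<^esub> - s\<^sub>k))\<close>.\<close>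
fun nested_sum :: "nat \<Rightarrow> nat \<Rightarrow> 'a" where
  "nested_sum 0 n = (if n = 0 then 1 else 0)"
| "nested_sum (Suc k) n = (\<Sum>s\<le>n. q ^ (s\<^sup>2) / qfact (n - s) * nested_sum k s)"

text \<open>Both sides satisfy the recursion of \<open>bailey_sum_step\<close>. The initial values agree because the
  triple product at \<open>z = 1\<close>, \<open>w = q\<close> contains the factor \<open>1 - z = 0\<close> as soon as \<open>n > 0\<close>.\<close>
lemma nested_sum_eq_bailey_sum:
  "nested_sum k n = bailey_sum (\<lambda>j. q ^ (k * j\<^sup>2) * theta_term 1 q j) n"
proof (induction k arbitrary: n)
  case 0
  show ?case
  proof (cases n)
    case (Suc m)
    have "qfact (2 * n) * bailey_sum (theta_term 1 q) n = (\<Prod>i<n. (1 - 1 * q ^ i) * (1 - q * q ^ i))"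
      by (rule finite_Jacobi_triple_product[symmetric]) simp
    also have "\<dots> = 0" by (rule prod_zero) (auto simp: Suc intro: bexI[of _ 0])
    finally have "bailey_sum (theta_term 1 q) n = 0" by simp
    then show ?thesis using Suc by simp
  qed (simp add: bailey_sum_def theta_term_def)
next
  case (Suc k)
  have "nested_sum (Suc k) n = bailey_sum (\<lambda>j. q ^ (j\<^sup>2) * (q ^ (k * j\<^sup>2) * theta_term 1 q j)) n"
    by (simp only: nested_sum.simps Suc bailey_sum_step)
  then show ?case by (simp add: power_add mult_ac)
qed

lemma finite_Euler:
  "(\<Sum>m\<le>n. (-1) ^ m * q ^ (m * (m + 1) div 2) * qbinomial n m) = qfact n"
proof -
  have "qfact n = (\<Prod>i<n. 1 - q * q ^ i)" by (simp add: qpoch_def)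
  also have "\<dots> = (\<Sum>m\<le>n. (-1) ^ m * q ^ (m * (m + 1) div 2) * qbinomial n m)"
    unfolding Rothe using triangle_Suc by (intro sum.cong refl) (simp add: power_add mult_ac)
  finally show ?thesis ..
qed

end

section \<open>Nested sums as sums over multiplicities\<close>

lemma finite_bounded_total:
  fixes i K s :: nat
  shows "finite {lam \<in> {i..K} \<rightarrow>\<^sub>E UNIV. (\<Sum>j=i..K. lam j) \<le> (s::nat)}"
proof (rule finite_subset)
  show "{lam \<in> {i..K} \<rightarrow>\<^sub>E UNIV. (\<Sum>j=i..K. lam j) \<le> s} \<subseteq> {i..K} \<rightarrow>\<^sub>E {..s}"
  proof
    fix lam assume lam: "lam \<in> {lam \<in> {i..K} \<rightarrow>\<^sub>E UNIV. (\<Sum>j=i..K. lam j) \<le> s}"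
    have "lam k \<le> s" if "k \<in> {i..K}" for k
      using lam member_le_sum[of k "{i..K}" lam] that by auto
    then show "lam \<in> {i..K} \<rightarrow>\<^sub>E {..s}" using lam by (auto simp: PiE_def Pi_def)
  qed
qed (auto intro: finite_PiE)

context q_base
begin

text \<open>The summand of the Andrews-Gordon series, restricted to the variables with indices \<open>i, \<dots>, K\<close>.\<close>
definition multi_weight :: "nat \<Rightarrow> nat \<Rightarrow> (nat \<Rightarrow> nat) \<Rightarrow> 'a" where
  "multi_weight i K lam = (\<Prod>r=i..K. q ^ ((\<Sum>j=r..K. lam j)\<^sup>2) / qfact (lam r))"

definition euler_term :: "nat \<Rightarrow> 'a" where
  "euler_term m = (-1) ^ m * q ^ (m * (m + 1) div 2) / qfact m"

text \<open>Expanding \<open>1/(q\<^sup>-\<^sup>1;q\<^sup>-\<^sup>1)\<^sub>m\<close> around \<open>q = 0\<close> produces the factor \<open>q\<^bsup>m(m+1)/2\<^esup>\<close> that makes the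
  sum over \<open>\<lambda>\<^bsub>p0\<^esub>\<close> converge.\<close>
lemma inverse_qpoch_inverse: "1 / qpoch (inverse q) (inverse q) m = euler_term m"
proof (induction m)
  case (Suc m)
  have nz: "1 - q ^ Suc m \<noteq> 0" using not_root_of_unity[of "Suc m"] by (simp del: power_Suc)
  have e: "1 - inverse q ^ Suc m = - ((1 - q ^ Suc m) / q ^ Suc m)"
    using q_nonzero by (simp add: power_inverse field_simps del: power_Suc)
  have "1 / qpoch (inverse q) (inverse q) (Suc m) =
      (1 / qpoch (inverse q) (inverse q) m) * (- (q ^ Suc m) / (1 - q ^ Suc m))"
    unfolding qpoch_Suc e by simp
  also have "\<dots> = euler_term m * (- (q ^ Suc m) / (1 - q ^ Suc m))"
    unfolding Suc ..
  also have "Suc m * (Suc m + 1) div 2 = m * (m + 1) div 2 + Suc m"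
    using triangle_Suc[of "Suc m"] by (simp add: mult.commute)
  then have "euler_term m * (- (q ^ Suc m) / (1 - q ^ Suc m)) = euler_term (Suc m)"
    unfolding euler_term_def qpoch_Suc by (simp add: power_add mult_ac)
  finally show ?case .
qed (simp add: euler_term_def)

lemma multi_weight_cong:
  "(\<And>j. i \<le> j \<Longrightarrow> j \<le> K \<Longrightarrow> lam j = mu j) \<Longrightarrow> multi_weight i K lam = multi_weight i K mu"
  unfolding multi_weight_def by (intro prod.cong refl arg_cong2[of _ _ _ _ "(/)"]) auto

lemma multi_weight_first:
  "i \<le> K \<Longrightarrow> multi_weight i K lam = q ^ ((\<Sum>j=i..K. lam j)\<^sup>2) / qfact (lam i) * multi_weight (Suc i) K lam"
  unfolding multi_weight_def by (simp add: prod.atLeast_Suc_atMost)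

text \<open>The nested summation variables are the tails \<open>N\<^sub>r\<close>, and the multiplicities are their
  differences. The induction removes the lowest index \<open>i\<close>: \<open>s\<close> and \<open>s'\<close> are the totals with
  and without it, and \<open>lam i = s - s'\<close>.\<close>
lemma sum_multi_weight:
  assumes "i + k = Suc K"
  shows "(\<Sum>lam | lam \<in> {i..K} \<rightarrow>\<^sub>E UNIV \<and> (\<Sum>j=i..K. lam j) = s. multi_weight i K lam)
    = q ^ (s\<^sup>2) * nested_sum k s"
  using assms
proof (induction k arbitrary: i s)
  case 0
  then have e: "{i..K} = {}" by simp
  have "{lam \<in> {i..K} \<rightarrow>\<^sub>E UNIV. (\<Sum>j=i..K. lam j) = s} = (if s = 0 then {\<lambda>_. undefined} else {})"
    unfolding e by auto
  then show ?case by (simp add: multi_weight_def e)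
next
  case (Suc k)
  define S where "S i s = {lam :: nat \<Rightarrow> nat. lam \<in> {i..K} \<rightarrow>\<^sub>E UNIV \<and> (\<Sum>j=i..K. lam j) = s}" for i s
  have iK: "i \<le> K" and ins: "{i..K} = insert i {Suc i..K}" using Suc.prems by auto
  have fin: "finite (S i s)" for i s
    by (rule finite_subset[OF _ finite_bounded_total[of i K s]]) (auto simp: S_def)
  have upd: "(\<Sum>j=Suc i..K. (mu(i := x)) j) = (\<Sum>j=Suc i..K. mu j)" for mu :: "nat \<Rightarrow> nat" and x
    by (intro sum.cong) auto
  have tot: "(\<Sum>j=i..K. mu j) = mu i + (\<Sum>j=Suc i..K. mu j)" for mu :: "nat \<Rightarrow> nat"
    using iK by (rule sum.atLeast_Suc_atMost)
  have "(\<Sum>lam\<in>S i s. multi_weight i K lam) =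
        (\<Sum>(s', mu)\<in>(SIGMA s':{..s}. S (Suc i) s'). q ^ (s\<^sup>2) / qfact (s - s') * multi_weight (Suc i) K mu)"
  proof (rule sum.reindex_bij_witness[of _ "\<lambda>(s', mu). mu(i := s - s')"
        "\<lambda>lam. (\<Sum>j=Suc i..K. lam j, lam(i := undefined))"])
    fix lam assume lam: "lam \<in> S i s"
    then have s: "s = lam i + (\<Sum>j=Suc i..K. lam j)" using tot[of lam] by (simp add: S_def)
    show "(case (\<Sum>j=Suc i..K. lam j, lam(i := undefined)) of (s', mu) \<Rightarrow> mu(i := s - s')) = lam"
      using s by auto
    show "(\<Sum>j=Suc i..K. lam j, lam(i := undefined)) \<in> (SIGMA s':{..s}. S (Suc i) s')"
      using lam s by (auto simp: S_def upd PiE_def extensional_def)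
    show "(case (\<Sum>j=Suc i..K. lam j, lam(i := undefined)) of (s', mu) \<Rightarrow>
        q ^ (s\<^sup>2) / qfact (s - s') * multi_weight (Suc i) K mu) = multi_weight i K lam"
      using s multi_weight_first[OF iK, of lam] tot[of lam] multi_weight_cong[of "Suc i" K "lam(i := undefined)" lam]
      by simp
  next
    fix p assume p: "p \<in> (SIGMA s':{..s}. S (Suc i) s')"
    obtain s' mu where ps: "p = (s', mu)" by (cases p)
    have mu: "s' \<le> s" "mu \<in> {Suc i..K} \<rightarrow>\<^sub>E UNIV" "(\<Sum>j=Suc i..K. mu j) = s'"
      using p by (auto simp: ps S_def)
    have "mu i = undefined" using mu(2) by (auto simp: PiE_def extensional_def)
    then show "(\<Sum>j=Suc i..K. (case p of (s', mu) \<Rightarrow> mu(i := s - s')) j, (case p of (s', mu) \<Rightarrow> mu(i := s - s'))(i := undefined)) = p"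
      using mu by (auto simp: ps upd)
    show "(case p of (s', mu) \<Rightarrow> mu(i := s - s')) \<in> S i s"
      using mu iK by (auto simp: ps S_def tot upd PiE_def extensional_def)
  qed
  also have "\<dots> = (\<Sum>s'\<le>s. \<Sum>mu\<in>S (Suc i) s'. q ^ (s\<^sup>2) / qfact (s - s') * multi_weight (Suc i) K mu)"
    by (rule sum.Sigma[symmetric]) (auto simp: fin)
  also have "\<dots> = (\<Sum>s'\<le>s. q ^ (s\<^sup>2) / qfact (s - s') * (q ^ (s'\<^sup>2) * nested_sum k s'))"
    unfolding sum_distrib_left[symmetric] using Suc.IH[of "Suc i"] Suc.prems by (simp add: S_def)
  also have "\<dots> = q ^ (s\<^sup>2) * nested_sum (Suc k) s"
    by (simp add: sum_distrib_left mult_ac)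
  finally show ?case by (simp add: S_def)
qed

end

section \<open>Approximation modulo powers of the variable\<close>

locale fls_base =
  fixes q :: "'a::field fls"
  assumes q_nz: "q \<noteq> 0" and ord_q: "ord_ge 1 q"
begin

lemma ord_power: "m \<le> n \<Longrightarrow> ord_ge (int m) (q ^ n)"
proof -
  have "ord_ge (int n) (q ^ n)" for n
  proof (induction n)
    case (Suc n)
    from ord_ge_mult[OF ord_q Suc] show ?case by (simp add: add.commute)
  qed simp
  then show "m \<le> n \<Longrightarrow> ord_ge (int m) (q ^ n)" by (meson ord_ge_mono of_nat_mono)
qed

sublocale q_base q
proof
  show "q \<noteq> 0" by (rule q_nz)
  fix n :: nat assume "n > 0"
  then have "ord_ge 1 (q ^ n)" using ord_power[of 1 n] by simp
  then show "q ^ n \<noteq> 1" by (auto simp: ord_ge_iff_subdegree q_nz)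
qed

lemma one_minus_power_near_one: "m \<le> n \<Longrightarrow> ord_ge (int m) ((1 - q ^ n) - 1)"
  using ord_power by (simp add: ord_ge_uminus)

lemma qfact_ratio_near_one:
  assumes "a \<le> m" "a \<le> n"
  shows "ord_ge (int (Suc a)) (qfact m / qfact n - 1)"
proof -
  have up: "ord_ge (int (Suc a)) (qfact (a + d) / qfact a - 1)" for d
  proof (induction d)
    case (Suc d)
    have "ord_ge (int (Suc a)) ((1 - q ^ Suc (a + d)) - 1)"
      by (rule one_minus_power_near_one) simp
    from near_one_mult[OF Suc this] show ?case by (simp add: qpoch_Suc del: power_Suc)
  qed simp
  have "ord_ge (int (Suc a)) (qfact m / qfact a * inverse (qfact n / qfact a) - 1)"
    using up[of "m - a"] up[of "n - a"] assms by (intro near_one_mult near_one_inverse) auto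
  then show ?thesis by simp
qed

lemma ord_qfact: "ord_ge 0 (qfact n)" "ord_ge 0 (1 / qfact n)"
  using near_one_integral[of 1 "qfact n"] qfact_ratio_near_one[of 0 n 0]
  by (simp_all add: inverse_eq_divide)

lemma ord_divide_qfact: "ord_ge N f \<Longrightarrow> ord_ge N (f / qfact n)"
  using ord_ge_mult_unit[OF _ ord_qfact(2)] by simp

lemma ord_euler_term: "ord_ge (int m) (euler_term m)"
proof -
  have "m \<le> m * (m + 1) div 2" by (cases m) auto
  then have "ord_ge (int m) (q ^ (m * (m + 1) div 2) * (-1) ^ m)"
    by (intro ord_ge_mult_unit ord_power ord_ge_sign)
  then show ?thesis unfolding euler_term_def by (intro ord_divide_qfact) (simp add: mult.commute)
qed

text \<open>The \<open>m\<close>-th term already has order at least \<open>m\<close>, so replacing \<open>1\<close> by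
  \<open>P N / P (N - m) = 1 + O(q\<^bsup>N-m+1\<^esup>)\<close> does not matter modulo \<open>t\<^sup>N\<close>; after the replacement the sum is
  the finite Euler identity. \<open>sum_nested_near\<close> and \<open>bailey_sum_near\<close> trade the order of a
  term against the precision of a quotient in the same way.\<close>
lemma sum_euler_term_near: "ord_ge (int N) ((\<Sum>m\<le>N. euler_term m) - qfact N)"
proof -
  have "ord_ge (int N) (euler_term m - (-1) ^ m * q ^ (m * (m + 1) div 2) * qbinomial N m)" if "m \<le> N" for m
  proof -
    have "ord_ge (int (Suc (N - m))) (qfact N / qfact (N - m) - 1)"
      using that by (intro qfact_ratio_near_one) auto
    from ord_ge_mult[OF ord_euler_term[of m] this]
    have "ord_ge (int N) (euler_term m * (qfact N / qfact (N - m) - 1))"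
      by (rule ord_ge_mono) (use that in simp)
    moreover have "euler_term m - (-1) ^ m * q ^ (m * (m + 1) div 2) * qbinomial N m
        = - (euler_term m * (qfact N / qfact (N - m) - 1))"
      using that by (simp add: euler_term_def qbinomial_def right_diff_distrib)
    ultimately show ?thesis by (simp add: ord_ge_uminus)
  qed
  then have "ord_ge (int N) (\<Sum>m\<le>N. euler_term m - (-1) ^ m * q ^ (m * (m + 1) div 2) * qbinomial N m)"
    by (intro ord_ge_sum) auto
  then show ?thesis unfolding sum_subtractf finite_Euler .
qed

lemma ord_nested_sum: "ord_ge 0 (nested_sum k n)"
proof (induction k arbitrary: n)
  case (Suc k)
  have "ord_ge 0 (q ^ (s\<^sup>2) / qfact (n - s) * nested_sum k s)" for s
    using ord_power[of 0 "s\<^sup>2"] by (intro ord_ge_mult_unit ord_divide_qfact Suc) simp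
  then show ?case by (simp add: ord_ge_sum)
qed simp

lemma sum_nested_near:
  "ord_ge (int N) ((\<Sum>s\<le>N. q ^ (s\<^sup>2) * nested_sum k s) - qfact N * nested_sum (Suc k) N)"
proof -
  have "ord_ge (int N) (q ^ (s\<^sup>2) * nested_sum k s - qfact N * (q ^ (s\<^sup>2) / qfact (N - s) * nested_sum k s))"
    if "s \<le> N" for s
  proof -
    have "ord_ge (int (Suc (N - s))) (qfact N / qfact (N - s) - 1)"
      using that by (intro qfact_ratio_near_one) auto
    moreover have "s \<le> s\<^sup>2" by (simp add: power2_eq_square)
    ultimately have "ord_ge (int s + int (Suc (N - s)))
        (q ^ (s\<^sup>2) * nested_sum k s * (qfact N / qfact (N - s) - 1))"
      by (intro ord_ge_mult ord_ge_mult_unit ord_power ord_nested_sum)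
    then have "ord_ge (int N) (q ^ (s\<^sup>2) * nested_sum k s * (qfact N / qfact (N - s) - 1))"
      by (rule ord_ge_mono) (use that in simp)
    then have "ord_ge (int N) (- (q ^ (s\<^sup>2) * nested_sum k s * (qfact N / qfact (N - s) - 1)))"
      by (simp only: ord_ge_uminus)
    then show ?thesis by (simp add: right_diff_distrib mult_ac)
  qed
  then have "ord_ge (int N) (\<Sum>s\<le>N. q ^ (s\<^sup>2) * nested_sum k s - qfact N * (q ^ (s\<^sup>2) / qfact (N - s) * nested_sum k s))"
    by (intro ord_ge_sum) auto
  then show ?thesis by (simp add: sum_subtractf sum_distrib_left)
qed

text \<open>Applied with \<open>M = N\<close> to the nested sums and with \<open>M = 2 N\<close> to the triple product.\<close>
lemma bailey_sum_near:
  assumes t: "\<And>j. ord_ge (int j) (t j)" and M: "N \<le> M"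
  shows "ord_ge (int N) (qfact N * qfact M * bailey_sum t N - (\<Sum>j\<le>N. t j))"
proof -
  have "ord_ge (int N) (t j * (qfact N / qfact (N - j) * (qfact M / qfact (N + j)) - 1))" if "j \<le> N" for j
  proof -
    have "ord_ge (int (Suc (N - j))) (qfact N / qfact (N - j) - 1)"
      and "ord_ge (int (Suc (N - j))) (qfact M / qfact (N + j) - 1)"
      using M by (intro qfact_ratio_near_one; simp)+
    then have "ord_ge (int (Suc (N - j))) (qfact N / qfact (N - j) * (qfact M / qfact (N + j)) - 1)"
      by (intro near_one_mult) auto
    from ord_ge_mult[OF t this] show ?thesis by (rule ord_ge_mono) (use that in simp)
  qed
  then have "ord_ge (int N) (\<Sum>j\<le>N. t j * (qfact N / qfact (N - j) * (qfact M / qfact (N + j)) - 1))"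
    by (intro ord_ge_sum) auto
  then show ?thesis
    by (simp add: bailey_sum_def sum_distrib_left right_diff_distrib sum_subtractf mult_ac)
qed

text \<open>The Andrews-Gordon identity multiplied by \<open>(q;q)\<^sub>\<infinity>\<close>, modulo \<open>t\<^sup>N\<close>: both sides are congruent to
  \<open>P N\<^sup>2\<close> times the \<open>k\<close>-fold nested sum up to \<open>N\<close>.\<close>
lemma euler_nested_near:
  assumes "k \<ge> 1"
  shows "ord_ge (int N) ((\<Sum>m\<le>N. euler_term m) * (\<Sum>s\<le>N. q ^ (s\<^sup>2) * nested_sum (k - 1) s)
    - (\<Sum>j\<le>N. q ^ (k * j\<^sup>2) * theta_term 1 q j))"
proof -
  have k: "Suc (k - 1) = k" using assms by simp
  have "ord_ge 0 (\<Sum>m\<le>N. euler_term m)"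
    by (intro ord_ge_sum ord_ge_mono[OF ord_euler_term]) simp
  moreover have "ord_ge 0 (qfact N * nested_sum k N)"
    by (intro ord_ge_mult_unit ord_qfact ord_nested_sum)
  ultimately have "ord_ge (int N) ((\<Sum>m\<le>N. euler_term m) * (\<Sum>s\<le>N. q ^ (s\<^sup>2) * nested_sum (k - 1) s)
       - qfact N * (qfact N * nested_sum k N))"
    using sum_euler_term_near sum_nested_near[of N "k - 1"] unfolding k by (intro ord_ge_mult_diff)
  moreover have "ord_ge (int N) (qfact N * qfact N * nested_sum k N - (\<Sum>j\<le>N. q ^ (k * j\<^sup>2) * theta_term 1 q j))"
    unfolding nested_sum_eq_bailey_sum
  proof (rule bailey_sum_near)
    fix j :: nat
    have "j \<le> j\<^sup>2" by (simp add: power2_eq_square)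
    also have "\<dots> \<le> k * j\<^sup>2" using assms by simp
    finally have "j \<le> k * j\<^sup>2" .
    moreover have "ord_ge 0 (theta_term 1 q j)"
      using ord_power[of 0] ord_ge_sign unfolding theta_term_def
      by (auto intro!: ord_ge_mult_unit ord_ge_add)
    ultimately show "ord_ge (int j) (q ^ (k * j\<^sup>2) * theta_term 1 q j)"
      by (intro ord_ge_mult_unit ord_power)
  qed simp
  ultimately show ?thesis by (auto dest: ord_ge_add simp: mult.assoc)
qed

lemma Jacobi_product_near:
  assumes zw: "z * w = q" and z: "ord_ge 1 z" and w: "ord_ge 1 w"
  shows "ord_ge (int N) ((\<Prod>i<N. (1 - q ^ Suc i) * (1 - z * q ^ i) * (1 - w * q ^ i)) - (\<Sum>j\<le>N. theta_term z w j))"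
proof -
  have "(\<Prod>i<N. (1 - q ^ Suc i) * (1 - z * q ^ i) * (1 - w * q ^ i)) = qfact N * qfact (2 * N) * bailey_sum (theta_term z w) N"
    using finite_Jacobi_triple_product[OF zw, of N] by (simp add: prod.distrib qpoch_def mult.assoc)
  moreover have "ord_ge (int N) (qfact N * qfact (2 * N) * bailey_sum (theta_term z w) N - (\<Sum>j\<le>N. theta_term z w j))"
  proof (rule bailey_sum_near)
    fix j
    have pw: "ord_ge (int j) (x ^ j)" if "ord_ge 1 x" for x :: "'a fls"
    proof (induction j)
      case (Suc j)
      from ord_ge_mult[OF that Suc] show ?case by (simp add: add.commute)
    qed simp
    have "ord_ge (int j) ((z ^ j + w ^ j) * ((-1) ^ j * q ^ (j * (j - 1) div 2)))"
      using ord_power[of 0] by (intro ord_ge_mult_unit ord_ge_add pw z w ord_ge_sign) simp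
    then show "ord_ge (int j) (theta_term z w j)"
      by (auto simp: theta_term_def mult.commute)
  qed simp
  ultimately show ?thesis by simp
qed

end

section \<open>The quadratic form\<close>

text \<open>Since \<open>min i j\<close> counts the \<open>r\<close> with \<open>r \<le> i\<close> and \<open>r \<le> j\<close>.\<close>
lemma sum_min_eq_sum_squares:
  fixes x :: "nat \<Rightarrow> rat"
  shows "(\<Sum>i=1..K. \<Sum>j=1..K. of_nat (min i j) * (x i * x j)) = (\<Sum>r=1..K. (\<Sum>j=r..K. x j)\<^sup>2)"
proof -
  have min: "of_nat (min i j) = (\<Sum>r=1..K. (if r \<le> i \<and> r \<le> j then 1 else 0 :: rat))"
    if "i \<in> {1..K}" "j \<in> {1..K}" for i j
  proof -
    have "{1..K} \<inter> {r. r \<le> i \<and> r \<le> j} = {1..min i j}" using that by auto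
    then show ?thesis by (simp add: sum.If_cases)
  qed
  have tail: "(\<Sum>j=r..K. x j) = (\<Sum>j=1..K. if r \<le> j then x j else 0)" if "r \<in> {1..K}" for r
  proof -
    have "{1..K} \<inter> {j. r \<le> j} = {r..K}" using that by auto
    then show ?thesis by (simp add: sum.If_cases)
  qed
  have "(\<Sum>i=1..K. \<Sum>j=1..K. of_nat (min i j) * (x i * x j))
     = (\<Sum>i=1..K. \<Sum>j=1..K. \<Sum>r=1..K. (if r \<le> i then x i else 0) * (if r \<le> j then x j else 0))"
    by (intro sum.cong refl) (simp only: min sum_distrib_right, intro sum.cong, auto)
  also have "\<dots> = (\<Sum>i=1..K. \<Sum>r=1..K. \<Sum>j=1..K. (if r \<le> i then x i else 0) * (if r \<le> j then x j else 0))"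
    by (intro sum.cong refl sum.swap)
  also have "\<dots> = (\<Sum>r=1..K. \<Sum>i=1..K. \<Sum>j=1..K. (if r \<le> i then x i else 0) * (if r \<le> j then x j else 0))"
    by (rule sum.swap)
  also have "\<dots> = (\<Sum>r=1..K. (\<Sum>j=r..K. x j)\<^sup>2)"
    by (intro sum.cong refl) (simp only: tail power2_eq_square sum_product)
  finally show ?thesis .
qed

lemma sum_tails: "(\<Sum>r=1..K. \<Sum>j=r..K. f j) = (\<Sum>j=1..K. j * f j)" for f :: "nat \<Rightarrow> nat"
proof -
  have "(\<Sum>r=1..K. \<Sum>j=r..K. f j) = (\<Sum>j=1..K. \<Sum>r=1..j. f j)"
    by (simp add: sum.Sigma del: sum_constant) (rule sum.reindex_bij_witness[of _ prod.swap prod.swap], auto)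
  then show ?thesis by simp
qed

definition sum_sq_tails :: "nat \<Rightarrow> (nat \<Rightarrow> nat) \<Rightarrow> nat" where
  "sum_sq_tails K lam = (\<Sum>r=1..K. (\<Sum>j=r..K. lam j)\<^sup>2)"

text \<open>Let \<open>L = \<Sum>i<p0. i \<lambda>\<^sub>i\<close> and \<open>y = -\<lambda>\<^bsub>p0\<^esub>\<close>. All contributions of \<open>\<Theta>\<close> with denominator \<open>p0\<close> combine to
  \<open>-(L - y)\<^sup>2/p0\<close>, and \<open>L - y = l\<close>; what remains is the form with matrix \<open>min i j\<close>.\<close>
lemma half_quad_completed:
  assumes "p0 \<ge> 1" "lam \<in> Lam p0 l"
  shows "of_nat (l\<^sup>2) / of_nat p0 + half_quad p0 lam = of_nat (sum_sq_tails (p0 - 1) lam)"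
proof -
  obtain K where K: "p0 = Suc K" using assms(1) by (cases p0) auto
  define x where "x j = (of_nat (lam j) :: rat)" for j
  define y where "y = - x p0"
  define P where "P = (of_nat p0 :: rat)"
  have P0: "P \<noteq> 0" using assms(1) by (simp add: P_def)
  define L where "L = (\<Sum>i=1..K. of_nat i * x i)"
  define v where "v j = of_int (eps p0 j) * x j" for j
  have v: "v p0 = y" "\<And>j. j \<in> {1..K} \<Longrightarrow> v j = x j" by (auto simp: v_def y_def eps_def K)
  have T: "Theta_entry p0 p0 p0 = - 1 / P"
    "\<And>j. j \<in> {1..K} \<Longrightarrow> Theta_entry p0 p0 j = of_nat j / P"
    "\<And>i. i \<in> {1..K} \<Longrightarrow> Theta_entry p0 i p0 = of_nat i / P"
    "\<And>i j. i \<in> {1..K} \<Longrightarrow> j \<in> {1..K} \<Longrightarrow> Theta_entry p0 i j = of_nat (min i j) - of_nat (i * j) / P"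
    by (auto simp: Theta_entry_def P_def K)
  have split: "(\<Sum>j=1..p0. f j) = (\<Sum>j=1..K. f j) + f p0" for f :: "nat \<Rightarrow> rat"
    by (simp add: K)
  have l: "of_nat l = L - y"
  proof -
    have "l = (\<Sum>k=1..p0. nn p0 k * lam k)" using assms(2) by (simp add: Lam_def)
    also have "\<dots> = (\<Sum>k=1..K. k * lam k) + lam p0" by (simp add: K nn_def)
    finally show ?thesis by (simp add: L_def y_def x_def)
  qed
  have "half_quad p0 lam = (\<Sum>i=0..<p0. v (Suc i) * (\<Sum>j=0..<p0. Theta_entry p0 (Suc i) (Suc j) * v (Suc j)))"
    by (simp add: half_quad_def lam_tilde_def B_mat_def Theta_eq Theta_mat_def scalar_prod_def v_def x_def
        sum_distrib_left mult_ac)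
  also have "\<dots> = (\<Sum>i=1..p0. v i * (\<Sum>j=1..p0. Theta_entry p0 i j * v j))"
  proof -
    have shift: "(\<Sum>i=0..<p0. g (Suc i)) = (\<Sum>i=1..p0. g i)" for g :: "nat \<Rightarrow> rat"
      by (rule sum.reindex_bij_witness[of _ "\<lambda>k. k - 1" Suc]) auto
    show ?thesis
      using shift[of "\<lambda>i. v i * (\<Sum>j=1..p0. Theta_entry p0 i j * v j)"]
        shift[of "\<lambda>j. Theta_entry p0 i j * v j" for i] by simp
  qed
  also have "\<dots> = (\<Sum>i=1..K. x i * ((\<Sum>j=1..K. (of_nat (min i j) - of_nat (i * j) / P) * x j) + of_nat i / P * y))
       + y * ((\<Sum>j=1..K. of_nat j / P * x j) + - 1 / P * y)"
    by (simp only: split) (simp add: v T)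
  also have "(\<Sum>j=1..K. of_nat j / P * x j) = L / P"
    by (simp add: L_def sum_divide_distrib)
  also have "(\<Sum>i=1..K. x i * ((\<Sum>j=1..K. (of_nat (min i j) - of_nat (i * j) / P) * x j) + of_nat i / P * y))
     = (\<Sum>i=1..K. \<Sum>j=1..K. of_nat (min i j) * (x i * x j)) - L * L / P + L / P * y"
  proof -
    have "L * L / P = (\<Sum>i=1..K. \<Sum>j=1..K. of_nat (i * j) / P * (x i * x j))"
      unfolding L_def sum_product sum_divide_distrib by (intro sum.cong refl) simp
    moreover have "L / P * y = (\<Sum>i=1..K. of_nat i / P * y * x i)"
      unfolding L_def sum_divide_distrib sum_distrib_right by (intro sum.cong refl) simp
    ultimately show ?thesis
      by (simp only: distrib_left left_diff_distrib right_diff_distrib sum.distrib sum_subtractf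
          sum_distrib_left mult_ac)
  qed
  also have "(\<Sum>i=1..K. \<Sum>j=1..K. of_nat (min i j) * (x i * x j)) = of_nat (sum_sq_tails K lam)"
    unfolding sum_min_eq_sum_squares by (simp add: sum_sq_tails_def x_def)
  finally have "half_quad p0 lam = of_nat (sum_sq_tails K lam) - L * L / P + L / P * y + y * (L / P + - 1 / P * y)" .
  moreover have "of_nat (l\<^sup>2) / of_nat p0 = (L - y)\<^sup>2 / P" by (simp add: l P_def)
  moreover have "(L - y)\<^sup>2 / P = L * L / P - L / P * y - y * (L / P) + y * y / P"
    using P0 by (simp add: power2_eq_square field_simps)
  ultimately show ?thesis by (simp add: K algebra_simps)
qed

section \<open>The partial sums and products\<close>

locale andrews_gordon =
  fixes p0 :: nat
  assumes p0_pos: "p0 \<ge> 1"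
begin

sublocale fls_base "qq p0"
proof
  show "qq p0 \<noteq> 0" by (simp add: qq_def)
  show "ord_ge 1 (qq p0)" using p0_pos by (simp add: ord_ge_iff_subdegree qq_def)
qed

abbreviation q where "q \<equiv> qq p0"

lemma qpow_of_nat: "qpow p0 (of_nat n) = q ^ n"
proof -
  have "\<lfloor>of_nat p0 * of_nat n :: rat\<rfloor> = int (p0 * n)"
    by (metis floor_of_nat of_nat_mult)
  then show ?thesis unfolding qpow_def qq_def by (simp add: power_mult flip: of_nat_mult)
qed

lemma qpow_add:
  assumes "of_nat p0 * r \<in> \<int>" "of_nat p0 * s \<in> \<int>"
  shows "qpow p0 r * qpow p0 s = qpow p0 (r + s)"
proof -
  obtain a b where ab: "of_nat p0 * r = of_int a" "of_nat p0 * s = of_int b" using assms by (auto elim!: Ints_cases)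
  then have sum: "of_nat p0 * (r + s) = of_int (a + b)" by (simp add: distrib_left)
  show ?thesis
    unfolding qpow_def ab sum floor_of_int by (rule power_int_add[symmetric]) simp
qed

definition full_weight :: "(nat \<Rightarrow> nat) \<Rightarrow> rat fls" where
  "full_weight lam = multi_weight 1 (p0 - 1) lam * euler_term (lam p0)"

lemma split_last: "prod f {1..p0} = prod f {1..p0 - 1} * f p0" "sum g {1..p0} = sum g {1..p0 - 1} + g p0"
  for f :: "nat \<Rightarrow> rat fls" and g :: "nat \<Rightarrow> nat"
  using p0_pos by (cases p0; simp)+

lemma multi_weight_eq: "multi_weight 1 K lam = q ^ sum_sq_tails K lam / (\<Prod>r=1..K. qfact (lam r))"
  by (simp add: multi_weight_def prod_dividef sum_sq_tails_def power_sum)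

lemma level_sum_eq:
  "qpow p0 (of_nat (l\<^sup>2) / of_nat p0) * V p0 l = (\<Sum>lam\<in>Lam p0 l. full_weight lam)"
proof -
  have "qpow p0 (of_nat (l\<^sup>2) / of_nat p0) * (qpow p0 (half_quad p0 lam) /
     (\<Prod>j=1..p0. qpoch (q powi eps p0 j) (q powi eps p0 j) (lam j))) = full_weight lam"
    if lam: "lam \<in> Lam p0 l" for lam
  proof -
    have "qpow p0 (of_nat (l\<^sup>2) / of_nat p0) * qpow p0 (half_quad p0 lam) = q ^ sum_sq_tails (p0 - 1) lam"
      using p0_pos exponent_integral[OF p0_pos, of lam] half_quad_completed[OF p0_pos lam]
      by (subst qpow_add) (simp_all add: qpow_of_nat del: of_nat_power)
    moreover have "(\<Prod>j=1..p0. qpoch (q powi eps p0 j) (q powi eps p0 j) (lam j)) =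
        (\<Prod>j=1..p0 - 1. qfact (lam j)) * qpoch (inverse q) (inverse q) (lam p0)"
      unfolding split_last using p0_pos
      by (intro arg_cong2[of _ _ _ _ "(*)"] prod.cong) (auto simp: eps_def power_int_minus)
    ultimately show ?thesis
      unfolding full_weight_def multi_weight_eq inverse_qpoch_inverse[symmetric] by simp
  qed
  then show ?thesis unfolding V_def sum_distrib_left by (intro sum.cong refl) blast
qed

lemma ord_full_weight: "ord_ge (int (\<Sum>k=1..p0. nn p0 k * lam k)) (full_weight lam)"
proof -
  define K where "K = p0 - 1"
  have "(\<Sum>k=1..K. k * lam k) = (\<Sum>r=1..K. \<Sum>j=r..K. lam j)" by (rule sum_tails[symmetric])
  also have "\<dots> \<le> sum_sq_tails K lam"
    unfolding sum_sq_tails_def by (intro sum_mono) (simp add: power2_eq_square)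
  finally have "ord_ge (int (\<Sum>k=1..K. k * lam k)) (q ^ sum_sq_tails K lam * (\<Prod>r=1..K. 1 / qfact (lam r)))"
    by (intro ord_ge_mult_unit ord_power ord_ge_prod ord_qfact)
  moreover have "multi_weight 1 K lam = q ^ sum_sq_tails K lam * (\<Prod>r=1..K. 1 / qfact (lam r))"
    unfolding multi_weight_eq prod_dividef by simp
  ultimately have "ord_ge (int (\<Sum>k=1..K. k * lam k)) (multi_weight 1 K lam)" by simp
  moreover have "(\<Sum>k=1..p0. nn p0 k * lam k) = (\<Sum>k=1..K. k * lam k) + lam p0"
    unfolding split_last K_def using p0_pos by (intro arg_cong2[of _ _ _ _ "(+)"] sum.cong) (auto simp: nn_def)
  ultimately show ?thesis
    unfolding full_weight_def K_def[symmetric] using ord_ge_mult[OF _ ord_euler_term] by fastforce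
qed

lemma sum_bounded_multi_weight:
  "(\<Sum>mu | mu \<in> {1..K} \<rightarrow>\<^sub>E UNIV \<and> (\<Sum>j=1..K. mu j) \<le> N. multi_weight 1 K mu)
    = (\<Sum>s\<le>N. q ^ (s\<^sup>2) * nested_sum K s)"
proof -
  define S where "S s = {mu \<in> {1..K} \<rightarrow>\<^sub>E UNIV. (\<Sum>j=1..K. mu j) = (s::nat)}" for s
  have fin: "finite (S s)" for s
    by (rule finite_subset[OF _ finite_bounded_total[of 1 K s]]) (auto simp: S_def)
  have "{mu \<in> {1..K} \<rightarrow>\<^sub>E UNIV. (\<Sum>j=1..K. mu j) \<le> N} = (\<Union>s\<le>N. S s)" by (auto simp: S_def)
  then have "(\<Sum>mu | mu \<in> {1..K} \<rightarrow>\<^sub>E UNIV \<and> (\<Sum>j=1..K. mu j) \<le> N. multi_weight 1 K mu)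
     = (\<Sum>s\<le>N. \<Sum>mu\<in>S s. multi_weight 1 K mu)"
    by (simp only:) (rule sum.UNION_disjoint, simp, simp add: fin, auto simp: S_def)
  then show ?thesis using sum_multi_weight[of 1 K K] by (simp add: S_def)
qed

text \<open>The left-hand side is summed over the \<open>\<lambda>\<close> of weight \<open>\<Sum> n\<^sub>k \<lambda>\<^sub>k < N\<close>. Enlarging this set to the
  box-like set \<open>B\<close>, on which the sum factorises, only adds terms of weight at least \<open>N\<close>, and the order
  of a term is at least its weight.\<close>
lemma partial_sum_near_product:
  "ord_ge (int N) ((\<Sum>l<N. qpow p0 (of_nat (l\<^sup>2) / of_nat p0) * V p0 l)
     - (\<Sum>m\<le>N. euler_term m) * (\<Sum>s\<le>N. q ^ (s\<^sup>2) * nested_sum (p0 - 1) s))"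
proof -
  define K where "K = p0 - 1"
  have K: "p0 = Suc K" using p0_pos by (simp add: K_def)
  define wt where "wt lam = (\<Sum>k=1..p0. nn p0 k * lam k)" for lam
  have wt: "wt lam = (\<Sum>k=1..K. k * lam k) + lam p0" for lam by (simp add: wt_def nn_def K)
  define A where "A = {lam \<in> {1..p0} \<rightarrow>\<^sub>E UNIV. wt lam < N}"
  define B where "B = {lam \<in> {1..p0} \<rightarrow>\<^sub>E UNIV. (\<Sum>k=1..K. lam k) \<le> N \<and> lam p0 \<le> N}"
  define C where "C = {mu \<in> {1..K} \<rightarrow>\<^sub>E UNIV. (\<Sum>k=1..K. mu k) \<le> N}"
  have AB: "A \<subseteq> B"
  proof
    fix lam assume lam: "lam \<in> A"
    have "(\<Sum>k=1..K. lam k) \<le> (\<Sum>k=1..K. k * lam k)" by (intro sum_mono) auto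
    then show "lam \<in> B" using lam by (auto simp: A_def B_def wt)
  qed
  have "B \<subseteq> {lam \<in> {1..p0} \<rightarrow>\<^sub>E UNIV. (\<Sum>k=1..p0. lam k) \<le> 2 * N}"
    by (auto simp: B_def K)
  then have finB: "finite B" by (rule finite_subset[OF _ finite_bounded_total])
  have finC: "finite C" unfolding C_def by (rule finite_bounded_total)
  have "(\<Sum>l<N. qpow p0 (of_nat (l\<^sup>2) / of_nat p0) * V p0 l) = (\<Sum>l<N. \<Sum>lam\<in>Lam p0 l. full_weight lam)"
    unfolding level_sum_eq ..
  also have "\<dots> = (\<Sum>lam\<in>(\<Union>l<N. Lam p0 l). full_weight lam)"
    by (rule sum.UNION_disjoint[symmetric]) (auto simp: finite_Lam, auto simp: Lam_def)
  also have "(\<Union>l<N. Lam p0 l) = A" by (auto simp: A_def Lam_def wt_def)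
  finally have F: "(\<Sum>l<N. qpow p0 (of_nat (l\<^sup>2) / of_nat p0) * V p0 l) = (\<Sum>lam\<in>A. full_weight lam)" .
  have "(\<Sum>lam\<in>B. full_weight lam) = (\<Sum>(m, mu)\<in>{..N} \<times> C. euler_term m * multi_weight 1 K mu)"
  proof (rule sum.reindex_bij_witness[of _ "\<lambda>(m, mu). mu(p0 := m)" "\<lambda>lam. (lam p0, lam(p0 := undefined))"])
    fix lam assume lam: "lam \<in> B"
    have "(\<Sum>k=1..K. (lam(p0 := undefined)) k) = (\<Sum>k=1..K. lam k)" by (intro sum.cong) (auto simp: K)
    then show "(lam p0, lam(p0 := undefined)) \<in> {..N} \<times> C"
      using lam by (auto simp: B_def C_def K PiE_def extensional_def)
    have "multi_weight 1 K (lam(p0 := undefined)) = multi_weight 1 K lam"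
      by (rule multi_weight_cong) (simp add: K)
    then show "(case (lam p0, lam(p0 := undefined)) of (m, mu) \<Rightarrow> euler_term m * multi_weight 1 K mu) = full_weight lam"
      by (simp add: full_weight_def K_def)
  next
    fix p assume p: "p \<in> {..N} \<times> C"
    obtain m mu where ps: "p = (m, mu)" by (cases p)
    have "mu p0 = undefined" using p by (auto simp: ps C_def K PiE_def extensional_def)
    then show "((case p of (m, mu) \<Rightarrow> mu(p0 := m)) p0, (case p of (m, mu) \<Rightarrow> mu(p0 := m))(p0 := undefined)) = p"
      by (auto simp: ps)
    have "(\<Sum>k=1..K. (mu(p0 := m)) k) = (\<Sum>k=1..K. mu k)" by (intro sum.cong) (auto simp: K)
    then show "(case p of (m, mu) \<Rightarrow> mu(p0 := m)) \<in> B"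
      using p by (auto simp: ps B_def C_def K PiE_def extensional_def)
  qed auto
  also have "\<dots> = (\<Sum>m\<le>N. euler_term m) * (\<Sum>mu\<in>C. multi_weight 1 K mu)"
    by (simp add: sum_product sum.cartesian_product)
  also have "(\<Sum>mu\<in>C. multi_weight 1 K mu) = (\<Sum>s\<le>N. q ^ (s\<^sup>2) * nested_sum K s)"
    unfolding C_def by (rule sum_bounded_multi_weight)
  finally have B: "(\<Sum>lam\<in>B. full_weight lam) = (\<Sum>m\<le>N. euler_term m) * (\<Sum>s\<le>N. q ^ (s\<^sup>2) * nested_sum (p0 - 1) s)"
    by (simp add: K_def)
  have "ord_ge (int N) (\<Sum>lam\<in>B - A. full_weight lam)"
  proof (rule ord_ge_sum)
    fix lam assume "lam \<in> B - A"
    then have "N \<le> wt lam" by (auto simp: A_def B_def)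
    then show "ord_ge (int N) (full_weight lam)"
      using ord_full_weight[of lam] unfolding wt_def by (meson ord_ge_mono of_nat_mono)
  qed
  moreover have "(\<Sum>lam\<in>A. full_weight lam) - (\<Sum>lam\<in>B. full_weight lam) = - (\<Sum>lam\<in>B - A. full_weight lam)"
    using sum.subset_diff[OF AB finB, of full_weight] by simp
  ultimately show ?thesis unfolding F B[symmetric] by (simp add: ord_ge_uminus)
qed

lemma partial_sum_near_theta:
  "ord_ge (int N) ((\<Sum>l<N. qpow p0 (of_nat (l\<^sup>2) / of_nat p0) * V p0 l)
     - (\<Sum>j\<le>N. q ^ (p0 * j\<^sup>2) * theta_term 1 q j))"
  using ord_ge_add[OF partial_sum_near_product euler_nested_near[OF p0_pos]] by simp

text \<open>The triple product in base \<open>q\<^bsup>2 p0 + 1\<^esup>\<close> with \<open>z = q\<^bsup>p0\<^esup>\<close> and \<open>w = q\<^bsup>p0 + 1\<^esup>\<close>.\<close>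
lemma product_near_theta:
  "ord_ge (int N) ((\<Prod>n<N. (1 - q ^ ((2 * p0 + 1) * Suc n)) * (1 - q ^ ((2 * p0 + 1) * Suc n - p0 - 1)) *
       (1 - q ^ ((2 * p0 + 1) * Suc n - p0))) - (\<Sum>j\<le>N. q ^ (p0 * j\<^sup>2) * theta_term 1 q j))"
proof -
  define M where "M = 2 * p0 + 1"
  interpret Q: fls_base "q ^ M"
    by unfold_locales (use q_nz ord_power[of 1 M] in \<open>auto simp: M_def\<close>)
  have theta: "Q.theta_term (q ^ p0) (q ^ (p0 + 1)) j = q ^ (p0 * j\<^sup>2) * theta_term 1 q j" for j
  proof (cases "j = 0")
    case False
    have "M * (j * (j - 1) div 2) + p0 * j = p0 * j\<^sup>2 + j * (j - 1) div 2"
    proof -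
      define T where "T = j * (j - 1) div 2"
      have "p0 * (2 * T + j) = p0 * (j * j)" unfolding T_def double_triangle ..
      then show ?thesis unfolding T_def[symmetric] by (simp add: M_def power2_eq_square algebra_simps)
    qed
    then have "(q ^ M) ^ (j * (j - 1) div 2) * (q ^ p0) ^ j = q ^ (p0 * j\<^sup>2) * q ^ (j * (j - 1) div 2)"
      by (metis power_add power_mult)
    moreover have "(q ^ (p0 + 1)) ^ j = (q ^ p0) ^ j * q ^ j"
      by (simp add: power_mult_distrib)
    ultimately show ?thesis
      using False unfolding Q.theta_term_def theta_term_def by (simp add: algebra_simps)
  qed (simp add: Q.theta_term_def theta_term_def)
  have factor: "(1 - q ^ (M * Suc n)) * (1 - q ^ (M * Suc n - p0 - 1)) * (1 - q ^ (M * Suc n - p0))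
      = (1 - (q ^ M) ^ Suc n) * (1 - q ^ p0 * (q ^ M) ^ n) * (1 - q ^ (p0 + 1) * (q ^ M) ^ n)" for n
  proof -
    have "M * Suc n - p0 - 1 = p0 + M * n" "M * Suc n - p0 = p0 + 1 + M * n" by (simp_all add: M_def)
    then show ?thesis by (simp only: power_add power_mult)
  qed
  have "ord_ge (int N) ((\<Prod>i<N. (1 - (q ^ M) ^ Suc i) * (1 - q ^ p0 * (q ^ M) ^ i) *
      (1 - q ^ (p0 + 1) * (q ^ M) ^ i)) - (\<Sum>j\<le>N. Q.theta_term (q ^ p0) (q ^ (p0 + 1)) j))"
  proof (rule Q.Jacobi_product_near)
    show "q ^ p0 * q ^ (p0 + 1) = q ^ M" by (simp add: M_def mult_2 flip: power_add)
    show "ord_ge 1 (q ^ p0)" "ord_ge 1 (q ^ (p0 + 1))"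
      using ord_power[of 1 p0] ord_power[of 1 "p0 + 1"] p0_pos by auto
  qed
  moreover have "(\<Sum>j\<le>N. Q.theta_term (q ^ p0) (q ^ (p0 + 1)) j) = (\<Sum>j\<le>N. q ^ (p0 * j\<^sup>2) * theta_term 1 q j)"
    by (intro sum.cong refl theta)
  ultimately show ?thesis unfolding M_def[symmetric] factor by (simp only:)
qed

text \<open>Each block of \<open>2 p0 + 1\<close> consecutive indices meets each of the three residue classes exactly
  once; the condition \<open>p0 \<ge> 1\<close> makes these classes distinct.\<close>
lemma block_product:
  fixes f :: "nat \<Rightarrow> rat fls"
  defines "M \<equiv> 2 * p0 + 1"
  shows "(\<Prod>n<N * M. if Suc n mod M \<in> {0, p0, p0 + 1} then f (Suc n) else 1)
    = (\<Prod>n<N. f (M * Suc n) * f (M * Suc n - p0 - 1) * f (M * Suc n - p0))"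
proof -
  have "(\<Prod>n\<in>{m * M..<m * M + M}. if Suc n mod M \<in> {0, p0, p0 + 1} then f (Suc n) else 1)
      = f (M * Suc m) * f (M * Suc m - p0 - 1) * f (M * Suc m - p0)" for m
  proof -
    have "(\<Prod>n\<in>{m * M..<m * M + M}. if Suc n mod M \<in> {0, p0, p0 + 1} then f (Suc n) else 1)
      = (\<Prod>n\<in>{m * M + 2 * p0, m * M + (p0 - 1), m * M + p0}. f (Suc n))"
    proof (rule prod.mono_neutral_cong_right)
      have "Suc (m * M + i) mod M = (if i = 2 * p0 then 0 else Suc i)" if "i < M" for i
      proof -
        have "Suc (m * M + i) mod M = (Suc i + m * M) mod M" by (simp add: add.commute)
        also have "\<dots> = Suc i mod M" by (rule mod_mult_self1)
        also have "\<dots> = (if i = 2 * p0 then 0 else Suc i)" using that by (simp add: M_def)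
        finally show ?thesis .
      qed
      then have md: "Suc n mod M = (if n - m * M = 2 * p0 then 0 else Suc (n - m * M))"
        if "n \<in> {m * M..<m * M + M}" for n
        using that by (metis add_diff_inverse_nat atLeastLessThan_iff nat_add_left_cancel_less not_le)
      show "\<forall>n\<in>{m * M..<m * M + M} - {m * M + 2 * p0, m * M + (p0 - 1), m * M + p0}.
         (if Suc n mod M \<in> {0, p0, p0 + 1} then f (Suc n) else 1) = 1"
        using md by auto
      show "(if Suc n mod M \<in> {0, p0, p0 + 1} then f (Suc n) else 1) = f (Suc n)"
        if "n \<in> {m * M + 2 * p0, m * M + (p0 - 1), m * M + p0}" for n
      proof -
        have "n \<in> {m * M..<m * M + M}" using that p0_pos by (auto simp: M_def)
        from md[OF this] show ?thesis using that p0_pos by auto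
      qed
    qed (use p0_pos in \<open>auto simp: M_def\<close>)
    also have "\<dots> = f (Suc (m * M + 2 * p0)) * (f (Suc (m * M + (p0 - 1))) * f (Suc (m * M + p0)))"
      using p0_pos by (subst prod.insert | simp)+
    also have "Suc (m * M + 2 * p0) = M * Suc m" by (simp add: M_def)
    also have "Suc (m * M + (p0 - 1)) = M * Suc m - p0 - 1" using p0_pos by (simp add: M_def)
    also have "Suc (m * M + p0) = M * Suc m - p0" by (simp add: M_def)
    finally show ?thesis by (simp add: mult_ac)
  qed
  then show ?thesis by (simp only: prod.nat_group[symmetric])
qed

end

section \<open>The identities\<close>

theorem mainTheorem3:
  fixes p0 :: nat
  assumes "p0 \<ge> 1"
  shows
    "let q = qq p0;
         F = (\<lambda>l. qpow p0 (of_nat (l^2) / of_nat p0) * V p0 l);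
         G = (\<lambda>k. (-1)^k * q^(k^2 * p0 + k * (k - 1) div 2) * (1 + q^k));
         H = (\<lambda>n. (1 - q^((2*p0+1)*n)) * (1 - q^((2*p0+1)*n - p0 - 1)) * (1 - q^((2*p0+1)*n - p0)));
         E = (\<lambda>n. 1 - q^n);
         P = (\<lambda>n. if n mod (2*p0+1) \<in> {0, p0, p0+1} then 1 else inverse (1 - q^n))
     in summable F \<and> summable (\<lambda>k. G (Suc k)) \<and>
        convergent_prod (\<lambda>n. H (Suc n)) \<and> convergent_prod (\<lambda>n. E (Suc n)) \<and>
        convergent_prod (\<lambda>n. P (Suc n)) \<and>
        (\<Sum>l. F l) = 1 + (\<Sum>k. G (Suc k)) \<and>
        (\<Sum>l. F l) = (\<Prod>n. H (Suc n)) \<and>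
        1 / (\<Prod>n. E (Suc n)) * (\<Sum>l. F l) = (\<Prod>n. P (Suc n))"
proof -
  interpret andrews_gordon p0 by unfold_locales (rule assms)
  define M where "M = 2 * p0 + 1"
  define F where "F = (\<lambda>l. qpow p0 (of_nat (l^2) / of_nat p0) * V p0 l)"
  define G where "G = (\<lambda>k. (-1)^k * q^(k^2 * p0 + k * (k - 1) div 2) * (1 + q^k))"
  define H where "H = (\<lambda>n. (1 - q^(M*n)) * (1 - q^(M*n - p0 - 1)) * (1 - q^(M*n - p0)))"
  define E where "E = (\<lambda>n. 1 - q^n)"
  define P where "P = (\<lambda>n. if n mod M \<in> {0, p0, p0+1} then 1 else inverse (1 - q^n))"
  have G_theta: "(\<Sum>j\<le>N. q ^ (p0 * j\<^sup>2) * theta_term 1 q j) = 1 + (\<Sum>k<N. G (Suc k))" for N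
  proof -
    have "(\<Sum>j\<le>N. q ^ (p0 * j\<^sup>2) * theta_term 1 q j) =
        theta_term 1 q 0 + (\<Sum>k<N. q ^ (p0 * (Suc k)\<^sup>2) * theta_term 1 q (Suc k))"
      by (simp add: sum.atMost_shift)
    moreover have "q ^ (p0 * (Suc k)\<^sup>2) * theta_term 1 q (Suc k) = G (Suc k)" for k
      unfolding G_def theta_term_def power_add by (simp add: mult_ac)
    ultimately show ?thesis by (simp add: theta_term_def)
  qed
  have sumG: "summable (\<lambda>k. G (Suc k))"
  proof (rule summable_fls)
    fix n
    have "n \<le> (Suc n)\<^sup>2 * p0 + Suc n * (Suc n - 1) div 2"
    proof -
      have "n \<le> (Suc n)\<^sup>2 * 1" by (simp add: power2_eq_square)
      also have "\<dots> \<le> (Suc n)\<^sup>2 * p0" using p0_pos by (intro mult_le_mono2)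
      finally show ?thesis by simp
    qed
    then have "ord_ge (int n) (q^((Suc n)^2 * p0 + Suc n * (Suc n - 1) div 2) * ((-1)^Suc n * (1 + q^Suc n)))"
      using ord_power[of 0 "Suc n"] by (intro ord_ge_mult_unit ord_power ord_ge_sign ord_ge_add) auto
    then show "ord_ge (int n) (G (Suc n))" by (simp only: G_def mult_ac)
  qed
  define L where "L = 1 + (\<Sum>k. G (Suc k))"
  have theta_lim: "(\<lambda>N. \<Sum>j\<le>N. q ^ (p0 * j\<^sup>2) * theta_term 1 q j) \<longlonglongrightarrow> L"
    using summable_LIMSEQ[OF sumG] unfolding G_theta L_def tendsto_fls_iff by simp
  have F_lim: "F sums L"
    unfolding sums_def F_def by (rule LIMSEQ_fls_near[OF partial_sum_near_theta theta_lim])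
  have H_lim: "(\<lambda>N. \<Prod>n<N. H (Suc n)) \<longlonglongrightarrow> L"
    unfolding H_def M_def by (rule LIMSEQ_fls_near[OF product_near_theta theta_lim])
  have H_near: "ord_ge (int (Suc n)) (H (Suc n) - 1)" for n
    unfolding H_def using p0_pos
    by (intro near_one_mult one_minus_power_near_one) (auto simp: M_def)
  have E_near: "ord_ge (int (Suc n)) (E (Suc n) - 1)" for n
    unfolding E_def by (intro one_minus_power_near_one) simp
  have P_near: "ord_ge (int (Suc n)) (P (Suc n) - 1)" for n
    using near_one_inverse[OF E_near[of n]] by (auto simp: P_def E_def)
  note prodH = fls_near_one_product[of "\<lambda>n. H (Suc n)", OF H_near]
  note prodE = fls_near_one_product[of "\<lambda>n. E (Suc n)", OF E_near]
  note prodP = fls_near_one_product[of "\<lambda>n. P (Suc n)", OF P_near]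
  have H: "(\<Prod>n. H (Suc n)) = L" using LIMSEQ_unique[OF prodH(2) H_lim] .
  \<comment> \<open>The cancellation is exact only after complete blocks, so the limit is taken along the multiples
    of \<open>2 p0 + 1\<close>.\<close>
  have M: "strict_mono (\<lambda>N. N * M)" by (intro strict_monoI mult_strict_right_mono) (simp_all add: M_def)
  have PE: "(\<Prod>n<N * M. P (Suc n)) * (\<Prod>n<N * M. E (Suc n)) = (\<Prod>n<N. H (Suc n))" for N
  proof -
    have "P (Suc n) * E (Suc n) = (if Suc n mod M \<in> {0, p0, p0 + 1} then E (Suc n) else 1)" for n
      using near_one_subdegree(1)[OF E_near[of n]] by (simp add: P_def E_def)
    then show ?thesis
      using block_product[of E N, folded M_def] by (simp add: H_def E_def flip: prod.distrib)
  qed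
  have "(\<lambda>N. (\<Prod>n<N * M. P (Suc n)) * (\<Prod>n<N * M. E (Suc n))) \<longlonglongrightarrow> (\<Prod>n. P (Suc n)) * (\<Prod>n. E (Suc n))"
    using LIMSEQ_subseq_LIMSEQ[OF prodP(2) M] LIMSEQ_subseq_LIMSEQ[OF prodE(2) M]
    by (intro tendsto_mult) (simp_all add: comp_def)
  then have "(\<Prod>n. P (Suc n)) * (\<Prod>n. E (Suc n)) = L"
    unfolding PE using H_lim LIMSEQ_unique by blast
  then have "1 / (\<Prod>n. E (Suc n)) * L = (\<Prod>n. P (Suc n))" using prodE(3) by (simp add: field_simps)
  then have "summable F \<and> summable (\<lambda>k. G (Suc k)) \<and>
        convergent_prod (\<lambda>n. H (Suc n)) \<and> convergent_prod (\<lambda>n. E (Suc n)) \<and>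
        convergent_prod (\<lambda>n. P (Suc n)) \<and>
        (\<Sum>l. F l) = 1 + (\<Sum>k. G (Suc k)) \<and>
        (\<Sum>l. F l) = (\<Prod>n. H (Suc n)) \<and>
        1 / (\<Prod>n. E (Suc n)) * (\<Sum>l. F l) = (\<Prod>n. P (Suc n))"
    using F_lim sumG prodH(1) prodE(1) prodP(1) H by (simp add: sums_iff L_def)
  then show ?thesis
    unfolding Let_def F_def G_def H_def E_def P_def M_def .
qed

end
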